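(* Let $g\in G_0(\Omega)$ be such that $\log g$ satisfies the weak Walters condition. Then there is a Borel probability measure $\nu$ on $\Omega$ such that for every $\varphi\in C(\Omega)$, $\mathscr{L}^n_{\log g}\varphi\to\int_\Omega\varphi\,d\nu$ uniformly on $\Omega$ as $n\to\infty$. Moreover, $\nu$ is the unique Borel probability measure satisfying $\mathscr{L}^*_{\log g}\nu=\nu$.
   Context: $(M,d)$ is a compact metric space and $\mu$ is a Borel probability measure on $M$ with $\operatorname{supp}\mu=M$. $\Omega=M^{\mathbb{N}}$ with metric $d_\Omega(x,y)=\sum_{n\ge1}2^{-n}d(x_n,y_n)$, $\sigma$ the left shift, $ax=(a,x_1,\dots)$ and $\mathbf{a}x=(a_1,\dots,a_n,x_1,\dots)$ for $\mathbf{a}\in M^n$. The Ruelle operator is $\mathscr{L}_f(\varphi)(x)=\int_M e^{f(ax)}\varphi(ax)\,d\mu(a)$, and $\mathscr{L}_f^*$ its dual acting on Borel measures. $G_0(\Omega)=\{g\in C(\Omega):g>0,\ \int_M g(ax)\,d\mu(a)=1\ \forall x\in\Omega\}$. $S_nf=\sum_{i=0}^{n-1}f\circ\sigma^i$; $C_f(x,y)=\sup_{n\ge1}\sup_{\mathbf{a}\in M^n}(S_nf(\mathbf{a}x)-S_nf(\mathbf{a}y))$; $f$ satisfies the weak Walters condition if $C_f(x,y)\to0$ as $d_\Omega(x,y)\to0$. *)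

theory Defs
  imports "HOL-Probability.Probability"
begin

(* Omega = M^N, sequences indexed from 0 (the paper indexes from 1).
   The metric d_Omega(x,y) = sum_{n>=1} 2^{-n} d(x_n,y_n). *)
definition dOmega :: "(nat \<Rightarrow> 'a::metric_space) \<Rightarrow> (nat \<Rightarrow> 'a) \<Rightarrow> real" where
  "dOmega x y = (\<Sum>n. (1/2) ^ (Suc n) * dist (x n) (y n))"

definition Omega_open :: "(nat \<Rightarrow> 'a::metric_space) set \<Rightarrow> bool" where
  "Omega_open U \<longleftrightarrow> (\<forall>x\<in>U. \<exists>e>0. \<forall>y. dOmega x y < e \<longrightarrow> y \<in> U)"

definition Omega_borel :: "(nat \<Rightarrow> 'a::metric_space) measure" where
  "Omega_borel = sigma UNIV (Collect Omega_open)"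

definition Omega_cont :: "((nat \<Rightarrow> 'a::metric_space) \<Rightarrow> real) \<Rightarrow> bool" where
  "Omega_cont \<phi> \<longleftrightarrow> (\<forall>x. \<forall>e>0. \<exists>d>0. \<forall>y. dOmega x y < d \<longrightarrow> \<bar>\<phi> y - \<phi> x\<bar> < e)"

definition shift :: "(nat \<Rightarrow> 'a) \<Rightarrow> (nat \<Rightarrow> 'a)" where
  "shift x = (\<lambda>k. x (Suc k))"

definition cons_seq :: "'a \<Rightarrow> (nat \<Rightarrow> 'a) \<Rightarrow> (nat \<Rightarrow> 'a)" where
  "cons_seq a x = case_nat a x"

(* for a word (a_1..a_n) in M^n (given by its first n values), (a_1..a_n,x_1,...) *)
definition prepend :: "nat \<Rightarrow> (nat \<Rightarrow> 'a) \<Rightarrow> (nat \<Rightarrow> 'a) \<Rightarrow> (nat \<Rightarrow> 'a)" where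
  "prepend n a x = (\<lambda>k. if k < n then a k else x (k - n))"

definition birkhoff_sum :: "nat \<Rightarrow> ((nat \<Rightarrow> 'a) \<Rightarrow> real) \<Rightarrow> (nat \<Rightarrow> 'a) \<Rightarrow> real" where
  "birkhoff_sum n f x = (\<Sum>i<n. f ((shift ^^ i) x))"

definition C_f :: "((nat \<Rightarrow> 'a) \<Rightarrow> real) \<Rightarrow> (nat \<Rightarrow> 'a) \<Rightarrow> (nat \<Rightarrow> 'a) \<Rightarrow> ereal" where
  "C_f f x y = (SUP n\<in>{1..}. SUP a\<in>UNIV.
      ereal (birkhoff_sum n f (prepend n a x) - birkhoff_sum n f (prepend n a y)))"

definition weak_walters :: "((nat \<Rightarrow> 'a::metric_space) \<Rightarrow> real) \<Rightarrow> bool" where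
  "weak_walters f \<longleftrightarrow>
     (\<forall>e>0. \<exists>d>0. \<forall>x y. dOmega x y < d \<longrightarrow> \<bar>C_f f x y\<bar> < ereal e)"

definition ruelle :: "'a measure \<Rightarrow> ((nat \<Rightarrow> 'a) \<Rightarrow> real) \<Rightarrow> ((nat \<Rightarrow> 'a) \<Rightarrow> real)
     \<Rightarrow> (nat \<Rightarrow> 'a) \<Rightarrow> real" where
  "ruelle \<mu> f \<phi> x = (\<integral>a. exp (f (cons_seq a x)) * \<phi> (cons_seq a x) \<partial>\<mu>)"

definition G0 :: "'a::metric_space measure \<Rightarrow> ((nat \<Rightarrow> 'a) \<Rightarrow> real) \<Rightarrow> bool" where
  "G0 \<mu> g \<longleftrightarrow> Omega_cont g \<and> (\<forall>x. g x > 0) \<and>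
     (\<forall>x. (\<integral>a. g (cons_seq a x) \<partial>\<mu>) = 1)"

(* L_f^* nu = nu, where the dual acts on Borel measures via
   int phi d(L_f^* nu) = int L_f phi d nu for all phi in C(Omega) *)
definition dual_fixed :: "'a::metric_space measure \<Rightarrow> ((nat \<Rightarrow> 'a) \<Rightarrow> real) \<Rightarrow> (nat \<Rightarrow> 'a) measure \<Rightarrow> bool" where
  "dual_fixed \<mu> f \<nu> \<longleftrightarrow>
     (\<forall>\<phi>. Omega_cont \<phi> \<longrightarrow> (\<integral>x. ruelle \<mu> f \<phi> x \<partial>\<nu>) = (\<integral>x. \<phi> x \<partial>\<nu>))"

end

theory Submission
  imports Defs
begin

text \<open>
  Write \<open>L\<close> for the Ruelle operator of \<open>ln g\<close>; it is positive and fixes constants. The weak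
  Walters condition makes the iterates \<open>L\<^sup>n \<phi>\<close> of a continuous function equicontinuous. Hence each of
  them stays close to its minimum on one of finitely many fixed balls. Since \<open>g > 0\<close> and \<open>\<mu>\<close> has full
  support, a fixed power \<open>L\<^sup>k\<close> carries a definite amount of each of these balls to every point, so it
  decreases the maximum of \<open>L\<^sup>n \<phi>\<close> by a definite proportion of its oscillation. The oscillation,
  which never increases, therefore tends to zero, and \<open>L\<^sup>n \<phi>\<close> converges uniformly to a constant that
  is a positive normalized linear functional of \<open>\<phi>\<close>. The Riesz representation theorem turns this
  functional into \<open>\<nu>\<close>. A fixed point \<open>\<nu>'\<close> of the dual operator integrates \<open>\<phi>\<close> and \<open>L\<^sup>n \<phi>\<close> to the
  same value, which must be the limit.
\<close>

section \<open>Riesz representation on a compact metric space\<close>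

locale normalized_positive_functional =
  fixes \<Lambda> :: "('b::metric_space \<Rightarrow> real) \<Rightarrow> real"
  assumes compact_UNIV: "compact (UNIV :: 'b set)"
    and functional_add: "\<And>\<phi> \<psi>. continuous_on UNIV \<phi> \<Longrightarrow> continuous_on UNIV \<psi> \<Longrightarrow>
           \<Lambda> (\<lambda>x. \<phi> x + \<psi> x) = \<Lambda> \<phi> + \<Lambda> \<psi>"
    and functional_scale: "\<And>c \<phi>. continuous_on UNIV \<phi> \<Longrightarrow> \<Lambda> (\<lambda>x. c * \<phi> x) = c * \<Lambda> \<phi>"
    and functional_mono: "\<And>\<phi> \<psi>. continuous_on UNIV \<phi> \<Longrightarrow> continuous_on UNIV \<psi> \<Longrightarrow>
           (\<And>x. \<phi> x \<le> \<psi> x) \<Longrightarrow> \<Lambda> \<phi> \<le> \<Lambda> \<psi>"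
    and functional_one: "\<Lambda> (\<lambda>x. 1) = 1"
begin

lemma functional_const: "\<Lambda> (\<lambda>x. c) = c"
  using functional_scale[of "\<lambda>x. 1" c] functional_one by simp

lemma functional_nonneg: "continuous_on UNIV \<phi> \<Longrightarrow> (\<And>x. 0 \<le> \<phi> x) \<Longrightarrow> 0 \<le> \<Lambda> \<phi>"
  using functional_mono[of "\<lambda>x. 0" \<phi>] functional_const[of 0] by simp

section \<open>Content of open sets and the induced outer measure\<close>

definition minorants :: "'b set \<Rightarrow> ('b \<Rightarrow> real) set" where
  "minorants U = {\<phi>. continuous_on UNIV \<phi> \<and> (\<forall>x. 0 \<le> \<phi> x \<and> \<phi> x \<le> indicator U x)}"

text \<open>This is the Riesz content, meaningful as a size for open \<open>U\<close>;
  \<open>outer\<close> extends it to all sets by approximation from outside.\<close>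

definition content :: "'b set \<Rightarrow> ennreal" where
  "content U = (SUP \<phi>\<in>minorants U. ennreal (\<Lambda> \<phi>))"

definition outer :: "'b set \<Rightarrow> ennreal" where
  "outer A = (INF U\<in>{U. open U \<and> A \<subseteq> U}. content U)"

lemma zero_minorant: "(\<lambda>x. 0) \<in> minorants U"
  by (simp add: minorants_def)

lemma minorants_nonempty: "minorants U \<noteq> {}"
  using zero_minorant by blast

lemma le_content: "\<phi> \<in> minorants U \<Longrightarrow> ennreal (\<Lambda> \<phi>) \<le> content U"
  unfolding content_def by (rule SUP_upper)

lemma content_mono: assumes "U \<subseteq> V" shows "content U \<le> content V"
proof -
  have "minorants U \<subseteq> minorants V"
  proof
    fix \<phi> assume \<phi>: "\<phi> \<in> minorants U"
    have "indicator U x \<le> (indicator V x :: real)" for x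
      using assms by (auto simp: indicator_def)
    then show "\<phi> \<in> minorants V"
      using \<phi> order_trans unfolding minorants_def by blast
  qed
  then show ?thesis
    unfolding content_def by (rule SUP_subset_mono) simp
qed

lemma content_empty: "content {} = 0"
proof -
  have "minorants {} = {\<lambda>x. 0}"
    by (auto simp: minorants_def fun_eq_iff intro: antisym)
  then show ?thesis
    by (simp add: content_def functional_const)
qed

lemma content_UNIV: "content UNIV = 1"
proof (rule antisym)
  show "content UNIV \<le> 1"
    unfolding content_def
  proof (rule SUP_least)
    fix \<phi> assume "\<phi> \<in> minorants UNIV"
    then have "\<Lambda> \<phi> \<le> \<Lambda> (\<lambda>x. 1)"
      by (intro functional_mono) (auto simp: minorants_def)
    then show "ennreal (\<Lambda> \<phi>) \<le> 1"
      by (simp add: functional_one)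
  qed
  have "(\<lambda>x. 1) \<in> minorants UNIV"
    by (simp add: minorants_def)
  from le_content[OF this] show "1 \<le> content UNIV"
    by (simp add: functional_one)
qed

lemma outer_open: "open U \<Longrightarrow> outer U = content U"
  unfolding outer_def by (intro antisym INF_lower INF_greatest) (auto intro: content_mono)

lemma outer_le_content: "open U \<Longrightarrow> A \<subseteq> U \<Longrightarrow> outer A \<le> content U"
  unfolding outer_def by (intro INF_lower) auto

lemma outer_mono: "A \<subseteq> B \<Longrightarrow> outer A \<le> outer B"
  unfolding outer_def by (rule INF_superset_mono) auto

lemma outer_finite: "outer A < top"
  using outer_mono[of A UNIV] outer_open[of UNIV] content_UNIV
  by (metis ennreal_one_less_top open_UNIV order_le_less_trans top_greatest)

end

text \<open>The distance to the closed complement vanishes exactly there. The whole space is treated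
  apart, because \<open>infdist\<close> to the empty set is zero by convention.\<close>

lemma open_positivity_set:
  fixes U :: "'b::metric_space set"
  assumes "open U"
  obtains h :: "'b \<Rightarrow> real"
  where "continuous_on UNIV h" "\<And>x. 0 \<le> h x" "\<And>x. 0 < h x \<longleftrightarrow> x \<in> U"
proof (cases "U = UNIV")
  case True
  then show ?thesis
    using that[of "\<lambda>x. 1"] by simp
next
  case False
  let ?h = "\<lambda>x. infdist x (- U)"
  have "0 < ?h x \<longleftrightarrow> x \<in> U" for x
  proof -
    have "- U \<noteq> {}" "closed (- U)"
      using assms False by auto
    then show ?thesis
      using in_closed_iff_infdist_zero[of "- U" x] infdist_nonneg[of x "- U"] by auto
  qed
  moreover have "continuous_on UNIV ?h"
    by (intro continuous_intros)
  ultimately show ?thesis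
    using that[of ?h] by (simp add: infdist_nonneg)
qed

context normalized_positive_functional
begin

text \<open>A minorant \<open>\<phi>\<close> of the union is lowered to
  \<open>max 0 (\<phi> x - e)\<close>, which vanishes off the compact set where
  \<open>e \<le> \<phi> x\<close>. There finitely many \<open>U i\<close> suffice, and truncation by
  partial sums of the \<open>h i\<close> cuts the lowered function into pieces that are minorants of
  single sets \<open>U j\<close>. This takes the place of a partition of unity.\<close>

lemma content_UN:
  assumes U: "\<And>i::nat. open (U i)"
  shows "content (\<Union>i. U i) \<le> (\<Sum>i. content (U i))"
  unfolding content_def[of "\<Union>i. U i"]
proof (rule SUP_least, rule ennreal_le_epsilon)
  fix \<phi> and e :: real
  assume "\<phi> \<in> minorants (\<Union>i. U i)" and e: "0 < e"
  then have cont: "continuous_on UNIV \<phi>" and \<phi>0: "\<And>x. 0 \<le> \<phi> x"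
    and \<phi>le: "\<And>x. \<phi> x \<le> indicator (\<Union>i. U i) x"
    by (auto simp: minorants_def)
  have \<phi>1: "\<phi> x \<le> 1" for x
    by (rule order_trans[OF \<phi>le indicator_le_1])
  have "\<exists>h::'b \<Rightarrow> real. continuous_on UNIV h \<and> (\<forall>x. 0 \<le> h x \<and> (0 < h x \<longleftrightarrow> x \<in> U i))" for i
    using open_positivity_set[OF U[of i]] by metis
  then obtain h :: "nat \<Rightarrow> 'b \<Rightarrow> real" where hcont: "\<And>i. continuous_on UNIV (h i)"
    and h0: "\<And>i x. 0 \<le> h i x" and hU: "\<And>i x. 0 < h i x \<longleftrightarrow> x \<in> U i"
    by metis
  \<comment> \<open>One index serves both as multiplier and as number of summands, so the sets
    \<open>V n\<close> increase and a finite subcover reduces to a single \<open>N\<close>.\<close>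
  define V where "V n = {x. 1 < real n * (\<Sum>i<n. h i x)}" for n
  have "compact {x. e \<le> \<phi> x}"
    using closed_Collect_le[OF continuous_on_const cont] compact_UNIV compact_Int_closed
    by fastforce
  moreover have "open (V n)" for n
    unfolding V_def by (intro open_Collect_less continuous_intros hcont)
  moreover have "{x. e \<le> \<phi> x} \<subseteq> (\<Union>n. V n)"
  proof
    fix x assume "x \<in> {x. e \<le> \<phi> x}"
    then have "x \<in> (\<Union>i. U i)"
      using \<phi>le[of x] e by (cases "x \<in> (\<Union>i. U i)") auto
    then obtain i where i: "0 < h i x"
      using hU by blast
    obtain m where m: "1 < real m * h i x"
      using reals_Archimedean3[OF i] by blast
    let ?n = "max m (Suc i)"
    have "h i x \<le> (\<Sum>j<?n. h j x)"
      by (rule member_le_sum) (auto simp: h0)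
    then have "real m * h i x \<le> real ?n * (\<Sum>j<?n. h j x)"
      by (intro mult_mono) (auto simp: h0)
    with m show "x \<in> (\<Union>n. V n)"
      unfolding V_def by (metis (mono_tags, lifting) UN_I UNIV_I mem_Collect_eq order_less_le_trans)
  qed
  ultimately obtain S where S: "finite S" "{x. e \<le> \<phi> x} \<subseteq> (\<Union>n\<in>S. V n)"
    by (rule compactE_image[of _ UNIV V]) auto
  \<comment> \<open>Inserting \<open>0\<close> keeps \<open>Max\<close> meaningful when
    \<open>S\<close> is empty.\<close>
  define N where "N = Max (insert 0 S)"
  have big: "1 < real N * (\<Sum>i<N. h i x)" if x: "e \<le> \<phi> x" for x
  proof -
    obtain n where n: "n \<in> S" "x \<in> V n"
      using S x by auto
    then have "n \<le> N"
      using S(1) by (simp add: N_def)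
    then have "real n * (\<Sum>i<n. h i x) \<le> real N * (\<Sum>i<N. h i x)"
      by (intro mult_mono sum_mono2) (auto simp: h0 sum_nonneg)
    with n show ?thesis
      by (simp add: V_def)
  qed
  define \<psi> where "\<psi> x = max 0 (\<phi> x - e)" for x
  \<comment> \<open>These truncations climb from \<open>F 0 = 0\<close> to
    \<open>F N = \<psi>\<close>, and passing from \<open>j\<close> to \<open>Suc j\<close> changes
    values only on \<open>U j\<close>, where \<open>h j\<close> is positive.\<close>
  define F where "F j x = min (\<psi> x) (real N * (\<Sum>i<j. h i x))" for j x
  have contF: "continuous_on UNIV (F j)" for j
    unfolding F_def \<psi>_def by (intro continuous_intros cont hcont)
  have "ennreal (\<Lambda> (F j)) \<le> (\<Sum>i<j. content (U i))" for j
  proof (induction j)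
    case 0
    have "F 0 = (\<lambda>x. 0)"
      by (auto simp: F_def \<psi>_def)
    then show ?case
      by (simp add: functional_const)
  next
    case (Suc j)
    let ?D = "\<lambda>x. F (Suc j) x - F j x"
    have contD: "continuous_on UNIV ?D"
      by (intro continuous_intros contF)
    have D0: "0 \<le> ?D x" for x
      unfolding F_def diff_ge_0_iff_ge by (intro min.mono mult_left_mono) (auto simp: h0)
    have "F j x \<le> F (Suc j) x \<and> F (Suc j) x - F j x \<le> indicator (U j) x" for x
    proof (cases "x \<in> U j")
      case True
      have "F (Suc j) x \<le> 1"
        using \<phi>1[of x] e by (auto simp: F_def \<psi>_def min_def)
      moreover have "0 \<le> F j x"
        by (simp add: F_def \<psi>_def h0 sum_nonneg)
      ultimately show ?thesis
        using True D0[of x] by simp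
    next
      case False
      then have "h j x = 0"
        using hU h0 by (metis order_le_less)
      then show ?thesis
        by (simp add: F_def)
    qed
    then have "?D \<in> minorants (U j)"
      using contD by (simp add: minorants_def)
    from le_content[OF this] have "ennreal (\<Lambda> (F j)) + ennreal (\<Lambda> ?D) \<le> (\<Sum>i<Suc j. content (U i))"
      using Suc.IH by (simp add: add_mono)
    moreover have "\<Lambda> (F (Suc j)) = \<Lambda> (F j) + \<Lambda> ?D"
      using functional_add[OF contF[of j] contD] by simp
    moreover have "0 \<le> \<Lambda> (F j)"
      by (rule functional_nonneg[OF contF]) (simp add: F_def \<psi>_def h0 sum_nonneg)
    moreover have "0 \<le> \<Lambda> ?D"
      by (rule functional_nonneg[OF contD D0])
    ultimately show ?case
      by simp
  qed
  moreover have "F N = \<psi>"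
  proof
    fix x
    show "F N x = \<psi> x"
    proof (cases "e \<le> \<phi> x")
      case True
      then show ?thesis
        using big[OF True] \<phi>1[of x] e by (auto simp: F_def \<psi>_def)
    next
      case False
      then show ?thesis
        by (simp add: F_def \<psi>_def h0 sum_nonneg)
    qed
  qed
  ultimately have "ennreal (\<Lambda> \<psi>) \<le> (\<Sum>i<N. content (U i))"
    by metis
  also have "\<dots> \<le> (\<Sum>i. content (U i))"
    by (rule sum_le_suminf) auto
  finally have le: "ennreal (\<Lambda> \<psi>) \<le> (\<Sum>i. content (U i))" .
  have cont\<psi>: "continuous_on UNIV \<psi>"
    unfolding \<psi>_def by (intro continuous_intros cont)
  have "\<Lambda> \<phi> \<le> \<Lambda> (\<lambda>x. \<psi> x + e)"
    by (intro functional_mono cont continuous_intros cont\<psi>) (auto simp: \<psi>_def)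
  also have "\<dots> = \<Lambda> \<psi> + e"
    using functional_add[OF cont\<psi> continuous_on_const] functional_const by simp
  finally have "ennreal (\<Lambda> \<phi>) \<le> ennreal (\<Lambda> \<psi>) + ennreal e"
    using functional_nonneg[OF cont\<psi>] e by (metis \<psi>_def ennreal_leI ennreal_plus max.cobounded1 less_imp_le)
  also have "\<dots> \<le> (\<Sum>i. content (U i)) + ennreal e"
    using le by (rule add_right_mono)
  finally show "ennreal (\<Lambda> \<phi>) \<le> (\<Sum>i. content (U i)) + ennreal e" .
qed

text \<open>Each \<open>A n\<close> is enclosed in an open set with error
  \<open>e / 2 ^ Suc n\<close>; finiteness of \<open>outer\<close> makes such a choice possible, and
  the errors sum to \<open>e\<close>.\<close>

lemma outer_UN: "outer (\<Union>i::nat. A i) \<le> (\<Sum>i. outer (A i))"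
proof (rule ennreal_le_epsilon)
  fix e :: real assume e: "0 < e"
  have "\<exists>U. open U \<and> A n \<subseteq> U \<and> content U \<le> outer (A n) + ennreal (e * (1/2) ^ Suc n)" for n
  proof -
    have "outer (A n) < outer (A n) + ennreal (e * (1/2) ^ Suc n)"
      using outer_finite[of "A n"] e by (cases "outer (A n)") (auto simp: ennreal_plus[symmetric] ennreal_less_iff simp del: ennreal_plus)
    then show ?thesis
      unfolding outer_def[of "A n"] INF_less_iff by (auto intro: less_imp_le)
  qed
  then obtain U where U: "\<And>n. open (U n)" "\<And>n. A n \<subseteq> U n"
    and le: "\<And>n. content (U n) \<le> outer (A n) + ennreal (e * (1/2) ^ Suc n)"
    by metis
  have "outer (\<Union>i. A i) \<le> content (\<Union>i. U i)"
    using U by (intro outer_le_content) auto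
  also have "\<dots> \<le> (\<Sum>i. content (U i))"
    by (rule content_UN) fact
  also have "\<dots> \<le> (\<Sum>i. outer (A i) + ennreal (e * (1/2) ^ Suc i))"
    by (rule suminf_le) (use le in blast, simp_all)
  also have "\<dots> = (\<Sum>i. outer (A i)) + (\<Sum>i. ennreal (e * (1/2) ^ Suc i))"
    by (rule suminf_add[symmetric]) auto
  also have "(\<Sum>i. ennreal (e * (1/2) ^ Suc i)) = ennreal e"
    using sums_mult[OF power_half_series, of e] e
    by (intro suminf_ennreal_eq) auto
  finally show "outer (\<Union>i. A i) \<le> (\<Sum>i. outer (A i)) + ennreal e" .
qed

text \<open>This is the nontrivial half of the Caratheodory condition. For a minorant
  \<open>\<phi>\<close> of \<open>V \<inter> U\<close>, the part of \<open>V\<close> where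
  \<open>\<phi> x < e\<close> is an open set containing \<open>V - U\<close>. Any minorant of that
  part can be added to \<open>\<phi>\<close> lowered by \<open>e\<close> without leaving the
  minorants of \<open>V\<close>.\<close>

lemma outer_split_open:
  assumes U: "open U"
  shows "outer (X \<inter> U) + outer (X - U) \<le> outer X"
  unfolding outer_def[of X]
proof (rule INF_greatest)
  fix V assume "V \<in> {V. open V \<and> X \<subseteq> V}"
  then have V: "open V" "X \<subseteq> V"
    by auto
  have main: "ennreal (\<Lambda> \<phi>) + outer (V - U) \<le> content V" if \<phi>: "\<phi> \<in> minorants (V \<inter> U)" for \<phi>
  proof (rule ennreal_le_epsilon)
    fix e :: real assume e: "0 < e"
    have cont: "continuous_on UNIV \<phi>" and \<phi>0: "\<And>x. 0 \<le> \<phi> x" and \<phi>le: "\<And>x. \<phi> x \<le> indicator (V \<inter> U) x"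
      using \<phi> by (auto simp: minorants_def)
    define W where "W = V \<inter> {x. \<phi> x < e}"
    have "open W"
      unfolding W_def using V by (intro open_Int open_Collect_less cont continuous_intros)
    moreover have "V - U \<subseteq> W"
    proof
      fix x assume "x \<in> V - U"
      then show "x \<in> W"
        using \<phi>le[of x] e by (auto simp: W_def)
    qed
    ultimately have "ennreal (\<Lambda> \<phi>) + outer (V - U) \<le> ennreal (\<Lambda> \<phi>) + content W"
      by (intro add_left_mono outer_le_content)
    also have "\<dots> = (SUP \<psi>\<in>minorants W. ennreal (\<Lambda> \<phi>) + ennreal (\<Lambda> \<psi>))"
      unfolding content_def by (rule ennreal_SUP_add_right) (rule minorants_nonempty)
    also have "\<dots> \<le> content V + ennreal e"
    proof (rule SUP_least)
      fix \<psi> assume \<psi>: "\<psi> \<in> minorants W"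
      have cont': "continuous_on UNIV \<psi>" and \<psi>0: "\<And>x. 0 \<le> \<psi> x" and \<psi>le: "\<And>x. \<psi> x \<le> indicator W x"
        using \<psi> by (auto simp: minorants_def)
      \<comment> \<open>The two summands are never positive at the same point: the first needs
        \<open>e < \<phi> x\<close>, the second \<open>\<phi> x < e\<close>.\<close>
      define \<theta> where "\<theta> x = max 0 (\<phi> x - e) + \<psi> x" for x
      have cont\<theta>: "continuous_on UNIV \<theta>"
        unfolding \<theta>_def by (intro continuous_intros cont cont')
      have "\<theta> x \<le> indicator V x" for x
        using \<phi>le[of x] \<psi>le[of x] \<phi>0[of x] \<psi>0[of x] e
        by (cases "x \<in> V"; cases "x \<in> U"; cases "\<phi> x < e") (auto simp: \<theta>_def W_def)
      then have "\<theta> \<in> minorants V"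
        using cont\<theta> \<psi>0 by (simp add: minorants_def \<theta>_def)
      have "\<Lambda> (\<lambda>x. \<phi> x + \<psi> x) \<le> \<Lambda> (\<lambda>x. \<theta> x + e)"
        by (intro functional_mono continuous_intros cont cont' cont\<theta>) (auto simp: \<theta>_def)
      then have "\<Lambda> \<phi> + \<Lambda> \<psi> \<le> \<Lambda> \<theta> + e"
        using functional_add[OF cont cont'] functional_add[OF cont\<theta> continuous_on_const[of _ e]]
          functional_const by simp
      moreover have "0 \<le> \<Lambda> \<phi>" "0 \<le> \<Lambda> \<psi>" "0 \<le> \<Lambda> \<theta>"
        using functional_nonneg cont cont' cont\<theta> \<phi>0 \<psi>0 by (auto simp: \<theta>_def)
      ultimately have "ennreal (\<Lambda> \<phi>) + ennreal (\<Lambda> \<psi>) \<le> ennreal (\<Lambda> \<theta>) + ennreal e"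
        using e by (metis ennreal_leI ennreal_plus less_imp_le)
      also have "\<dots> \<le> content V + ennreal e"
        by (intro add_right_mono le_content) fact
      finally show "ennreal (\<Lambda> \<phi>) + ennreal (\<Lambda> \<psi>) \<le> content V + ennreal e" .
    qed
    finally show "ennreal (\<Lambda> \<phi>) + outer (V - U) \<le> content V + ennreal e" .
  qed
  have "outer (X \<inter> U) + outer (X - U) \<le> content (V \<inter> U) + outer (V - U)"
    using V U by (intro add_mono outer_le_content outer_mono) auto
  also have "\<dots> = (SUP \<phi>\<in>minorants (V \<inter> U). ennreal (\<Lambda> \<phi>) + outer (V - U))"
    unfolding content_def by (rule ennreal_SUP_add_left[symmetric]) (rule minorants_nonempty)
  also have "\<dots> \<le> content V"
    by (rule SUP_least) (rule main)
  finally show "outer (X \<inter> U) + outer (X - U) \<le> content V" .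
qed

text \<open>Caratheodory's lemma makes \<open>outer\<close> a measure on the sets that split every
  set additively. Open sets do so by \<open>outer_split_open\<close>, hence all Borel sets
  do.\<close>

lemma measure_space_outer: "measure_space UNIV (sets borel) outer"
proof -
  have outer_empty: "outer {} = 0"
    using outer_open[of "{}"] by (simp add: content_empty)
  have oms: "outer_measure_space (Pow UNIV) outer"
    unfolding outer_measure_space_def positive_def increasing_def countably_subadditive_def
    using outer_empty outer_mono outer_UN by auto
  interpret P: sigma_algebra UNIV "Pow UNIV :: 'b set set"
    by (rule sigma_algebra_Pow)
  let ?L = "lambda_system UNIV (Pow UNIV) outer"
  have ms: "measure_space UNIV ?L outer"
    using P.caratheodory_lemma[OF oms] .
  have "U \<in> ?L" if U: "open U" for U
  proof -
    have "outer (X \<inter> U) + outer (X - U) = outer X" for X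
    proof (rule antisym)
      have "outer ((X \<inter> U) \<union> (X - U)) \<le> outer (X \<inter> U) + outer (X - U)"
        using P.countably_subadditive_subadditive[of outer] oms
        unfolding outer_measure_space_def subadditive_def by (metis Int_Diff_disjoint Pow_UNIV UNIV_I)
      then show "outer X \<le> outer (X \<inter> U) + outer (X - U)"
        by (simp add: Int_Diff_Un)
    qed (rule outer_split_open[OF U])
    then show ?thesis
      unfolding P.lambda_system_eq by blast
  qed
  then have "sets borel \<subseteq> ?L"
    using ms sigma_algebra.sigma_sets_subset[of UNIV ?L "Collect open"]
    unfolding borel_def measure_space_def by auto
  then show ?thesis
    using ms sets.sigma_algebra_axioms[of "borel :: 'b measure"]
    unfolding measure_space_def positive_def countably_additive_def
    by (auto simp: subset_iff)
qed

definition representing_measure :: "'b measure" where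
  "representing_measure = measure_of UNIV (sets borel) outer"

lemma sets_representing_measure [simp]: "sets representing_measure = sets borel"
  unfolding representing_measure_def by (metis sets.sets_measure_of_eq space_borel)

lemma space_representing_measure [simp]: "space representing_measure = UNIV"
  unfolding representing_measure_def by (simp add: space_measure_of_conv)

lemma emeasure_representing_open:
  assumes "open U"
  shows "emeasure representing_measure U = content U"
proof -
  have "emeasure representing_measure U = outer U"
    unfolding representing_measure_def
    using measure_space_outer assms
    by (intro emeasure_measure_of_sigma) (auto simp: measure_space_def)
  then show ?thesis
    by (simp add: outer_open assms)
qed

lemma prob_space_representing_measure: "prob_space representing_measure"
  by (rule prob_spaceI) (simp add: emeasure_representing_open content_UNIV)

end

section \<open>Representation of the functional as an integral\<close>

lemma bounded_continuous_on_compact_UNIV: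
  fixes \<phi> :: "'b::topological_space \<Rightarrow> real"
  assumes "compact (UNIV :: 'b set)" "continuous_on UNIV \<phi>"
  obtains B where "0 < B" "\<And>x. \<bar>\<phi> x\<bar> \<le> B"
  using compact_imp_bounded[OF compact_continuous_image[OF assms(2,1)]]
  unfolding bounded_pos by auto

lemma integrable_continuous_compact:
  fixes \<phi> :: "'b::topological_space \<Rightarrow> real"
  assumes "compact (UNIV :: 'b set)" "continuous_on UNIV \<phi>" "prob_space M" "sets M = sets borel"
  shows "integrable M \<phi>"
proof -
  interpret prob_space M by fact
  obtain B where "\<And>x. \<bar>\<phi> x\<bar> \<le> B"
    using bounded_continuous_on_compact_UNIV assms by metis
  moreover have "\<phi> \<in> borel_measurable M"
    using borel_measurable_continuous_onI[OF assms(2)] measurable_cong_sets[OF assms(4) refl] by blast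
  ultimately show ?thesis
    by (intro integrable_const_bound[where B = B]) auto
qed

context normalized_positive_functional
begin

text \<open>Cutting \<open>\<phi>\<close> into horizontal slices of height \<open>1/n\<close>, the functional of each slice is
  dominated by the integral of the slice below it.\<close>

lemma functional_le_integral_unit:
  assumes cont: "continuous_on UNIV \<phi>" and \<phi>0: "\<And>x. 0 \<le> \<phi> x" and \<phi>1: "\<And>x. \<phi> x \<le> 1"
  shows "\<Lambda> \<phi> \<le> (\<integral>x. \<phi> x \<partial>representing_measure)"
proof (rule field_le_epsilon)
  let ?\<nu> = representing_measure
  interpret prob_space ?\<nu>
    by (rule prob_space_representing_measure)
  have int: "integrable ?\<nu> \<psi>" if "continuous_on UNIV \<psi>" for \<psi> :: "'b \<Rightarrow> real"
    using integrable_continuous_compact[OF compact_UNIV that prob_space_representing_measure] by simp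
  fix e :: real assume "0 < e"
  then obtain n :: nat where n: "0 < n" "1 / real n < e"
    by (metis nat_approx_posE zero_less_Suc)
  define F where "F k x = min (\<phi> x) (real k / real n)" for k x
  have contF: "continuous_on UNIV (F k)" for k
    unfolding F_def by (intro continuous_intros cont)
  \<comment> \<open>\<open>D k\<close> is the slice between the heights \<open>k / n\<close> and
    \<open>(k + 1) / n\<close>. It lies between the indicators of \<open>U (Suc k)\<close> and
    \<open>U k\<close>, both divided by \<open>n\<close>: the upper one bounds the functional, the
    lower one the integral.\<close>
  define D where "D k x = F (Suc k) x - F k x" for k x
  have contD: "continuous_on UNIV (D k)" for k
    unfolding D_def by (intro continuous_intros contF)
  have D0: "0 \<le> D k x" for k x
    unfolding D_def F_def diff_ge_0_iff_ge by (intro min.mono divide_right_mono) auto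
  define U where "U k = {x. real k / real n < \<phi> x}" for k
  have openU: "open (U k)" for k
    unfolding U_def by (intro open_Collect_less cont continuous_intros)
  have up: "\<Lambda> (D k) \<le> prob (U k) / real n" for k
  proof -
    have "real n * D k x \<le> indicator (U k) x" for x
      using n(1) by (auto simp: D_def F_def U_def min_def indicator_def field_simps)
    then have "(\<lambda>x. real n * D k x) \<in> minorants (U k)"
      using contD D0 by (auto simp: minorants_def intro!: continuous_intros)
    from le_content[OF this] have "ennreal (real n * \<Lambda> (D k)) \<le> ennreal (prob (U k))"
      using emeasure_representing_open[OF openU] functional_scale[OF contD]
      by (simp add: emeasure_eq_measure)
    then show ?thesis
      using n(1) by (simp add: field_simps)
  qed
  have low: "prob (U (Suc k)) / real n \<le> (\<integral>x. D k x \<partial>?\<nu>)" for k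
  proof -
    have "(\<integral>x. indicator (U (Suc k)) x / real n \<partial>?\<nu>) \<le> (\<integral>x. D k x \<partial>?\<nu>)"
    proof (rule integral_mono)
      show "integrable ?\<nu> (\<lambda>x. indicator (U (Suc k)) x / real n)"
        using openU by (intro integrable_divide) (auto simp: emeasure_eq_measure)
      show "indicator (U (Suc k)) x / real n \<le> D k x" for x
        using n(1) D0[of k x] by (auto simp: D_def F_def U_def min_def indicator_def field_simps)
    qed (rule int[OF contD])
    then show ?thesis
      by simp
  qed
  \<comment> \<open>The two bounds match after a shift by one slice; the unmatched lowest slice
    costs at most \<open>1 / n\<close>.\<close>
  have "\<Lambda> (F (Suc k)) \<le> 1 / real n + (\<integral>x. F k x \<partial>?\<nu>)" for k
  proof (induction k)
    case 0
    have "\<Lambda> (F 1) \<le> \<Lambda> (\<lambda>x. 1 / real n)"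
      by (intro functional_mono contF) (auto simp: F_def)
    moreover have "0 \<le> (\<integral>x. F 0 x \<partial>?\<nu>)"
      by (rule integral_nonneg_AE) (auto simp: F_def \<phi>0)
    ultimately show ?case
      by (simp add: functional_const)
  next
    case (Suc k)
    have "\<Lambda> (F (Suc (Suc k))) = \<Lambda> (F (Suc k)) + \<Lambda> (D (Suc k))"
      using functional_add[OF contF[of "Suc k"] contD[of "Suc k"]] by (simp add: D_def)
    also have "\<dots> \<le> 1 / real n + (\<integral>x. F k x \<partial>?\<nu>) + (\<integral>x. D k x \<partial>?\<nu>)"
      using Suc.IH up[of "Suc k"] low[of k] by simp
    also have "\<dots> = 1 / real n + (\<integral>x. F (Suc k) x \<partial>?\<nu>)"
      using int[OF contF] by (simp add: D_def)
    finally show ?case .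
  qed
  from this[of n] have "\<Lambda> (F (Suc n)) \<le> 1 / real n + (\<integral>x. F n x \<partial>?\<nu>)" .
  moreover have "F k = \<phi>" if "n \<le> k" for k
  proof
    fix x
    have "1 \<le> real k / real n"
      using that n(1) by simp
    then show "F k x = \<phi> x"
      using \<phi>1[of x] by (simp add: F_def)
  qed
  ultimately show "\<Lambda> \<phi> \<le> (\<integral>x. \<phi> x \<partial>?\<nu>) + e"
    using n(2) by simp
qed

text \<open>An affine change of values carries the inequality from functions into the unit interval
  to all continuous functions. Applied to both \<open>\<phi>\<close> and its negative, it becomes an
  equality.\<close>

theorem integral_representing_measure:
  assumes cont: "continuous_on UNIV \<phi>"
  shows "(\<integral>x. \<phi> x \<partial>representing_measure) = \<Lambda> \<phi>"
proof -
  let ?\<nu> = representing_measure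
  interpret prob_space ?\<nu>
    by (rule prob_space_representing_measure)
  have int: "integrable ?\<nu> \<psi>" if "continuous_on UNIV \<psi>" for \<psi> :: "'b \<Rightarrow> real"
    using integrable_continuous_compact[OF compact_UNIV that prob_space_representing_measure] by simp
  have le: "\<Lambda> \<psi> \<le> (\<integral>x. \<psi> x \<partial>?\<nu>)" if cont: "continuous_on UNIV \<psi>" for \<psi>
  proof -
    obtain B where B: "0 < B" "\<And>x. \<bar>\<psi> x\<bar> \<le> B"
      using bounded_continuous_on_compact_UNIV[OF compact_UNIV cont] by metis
    define \<theta> where "\<theta> x = inverse (2 * B) * (\<psi> x + B)" for x
    have c: "continuous_on UNIV (\<lambda>x. \<psi> x + B)"
      by (intro continuous_intros cont)
    have "\<Lambda> \<theta> \<le> (\<integral>x. \<theta> x \<partial>?\<nu>)"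
    proof (rule functional_le_integral_unit)
      show "continuous_on UNIV \<theta>"
        unfolding \<theta>_def by (intro continuous_intros cont)
      show "0 \<le> \<theta> x" "\<theta> x \<le> 1" for x
        using B(1) B(2)[of x] by (auto simp: \<theta>_def field_simps)
    qed
    moreover have "\<Lambda> \<theta> = inverse (2 * B) * (\<Lambda> \<psi> + B)"
      unfolding \<theta>_def functional_scale[OF c] functional_add[OF cont continuous_on_const] functional_const ..
    moreover have "(\<integral>x. \<theta> x \<partial>?\<nu>) = inverse (2 * B) * ((\<integral>x. \<psi> x \<partial>?\<nu>) + B)"
      unfolding \<theta>_def using int[OF cont] prob_space by simp
    ultimately show ?thesis
      using B(1) by simp
  qed
  have "\<Lambda> (\<lambda>x. - \<phi> x) \<le> (\<integral>x. - \<phi> x \<partial>?\<nu>)"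
    by (intro le continuous_intros cont)
  moreover have "\<Lambda> (\<lambda>x. - \<phi> x) = - \<Lambda> \<phi>"
    using functional_scale[OF cont, of "-1"] by simp
  ultimately show ?thesis
    using le[OF cont] by simp
qed

end

text \<open>The functions \<open>min 1 (n * h x)\<close> converge boundedly to the indicator of an
  open set, so integrals of continuous functions determine the measure of open sets, an
  intersection-stable generator.\<close>

lemma prob_measure_eqI_integral_continuous:
  fixes M N :: "'b::metric_space measure"
  assumes "prob_space M" "prob_space N" and sets: "sets M = sets borel" "sets N = sets borel"
    and eq: "\<And>\<phi>. continuous_on UNIV \<phi> \<Longrightarrow> (\<integral>x. \<phi> x \<partial>M) = (\<integral>x. \<phi> x \<partial>N :: real)"
  shows "M = N"
proof -
  interpret M: prob_space M by fact
  interpret N: prob_space N by fact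
  have emeasure_eq: "emeasure M U = emeasure N U" if U: "open U" for U
  proof -
    obtain h :: "'b \<Rightarrow> real" where h: "continuous_on UNIV h" "\<And>x. 0 \<le> h x" "\<And>x. 0 < h x \<longleftrightarrow> x \<in> U"
      using open_positivity_set[OF U] by metis
    define F where "F n x = min 1 (real n * h x)" for n x
    have contF: "continuous_on UNIV (F n)" for n
      unfolding F_def by (intro continuous_intros h)
    have lim: "(\<lambda>n. F n x) \<longlonglongrightarrow> indicator U x" for x
    proof (cases "x \<in> U")
      case True
      then obtain n0 :: nat where n0: "1 < real n0 * h x"
        using reals_Archimedean3 h(3) by blast
      have "F n x = 1" if "n0 \<le> n" for n
      proof -
        have "real n0 * h x \<le> real n * h x"
          using that h(2) by (intro mult_right_mono) auto
        then show ?thesis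
          using n0 by (simp add: F_def)
      qed
      then show ?thesis
        using True by (intro tendsto_eventually) (auto simp: eventually_sequentially)
    next
      case False
      then have "h x = 0"
        using h(2,3) by (metis order_le_less)
      then show ?thesis
        using False by (simp add: F_def)
    qed
    have conv: "(\<lambda>n. \<integral>x. F n x \<partial>L) \<longlonglongrightarrow> measure L U" if L: "prob_space L" "sets L = sets borel" for L
    proof -
      interpret L: prob_space L by fact
      have "(\<lambda>n. \<integral>x. F n x \<partial>L) \<longlonglongrightarrow> (\<integral>x. indicator U x \<partial>L)"
      proof (rule integral_dominated_convergence[where w = "\<lambda>x. 1"])
        show "F n \<in> borel_measurable L" for n
          using borel_measurable_continuous_onI[OF contF] measurable_cong_sets[OF L(2) refl] by blast
        show "(indicator U :: 'b \<Rightarrow> real) \<in> borel_measurable L"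
          using U L(2) by (intro borel_measurable_indicator) simp
      next
        show "AE x in L. (\<lambda>n. F n x) \<longlonglongrightarrow> indicator U x"
          using lim by simp
      qed (auto simp: F_def h(2))
      then show ?thesis
        using U L(2) sets_eq_imp_space_eq[OF L(2)] by simp
    qed
    have "measure M U = measure N U"
      using conv[OF assms(1) sets(1)] conv[OF assms(2) sets(2)] eq[OF contF]
      by (simp add: LIMSEQ_unique)
    then show ?thesis
      by (simp add: M.emeasure_eq_measure N.emeasure_eq_measure)
  qed
  show ?thesis
  proof (rule measure_eqI_generator_eq[where E = "Collect open" and \<Omega> = UNIV and A = "\<lambda>_. UNIV"])
    show "Int_stable (Collect open :: 'b set set)"
      by (auto simp: Int_stable_def)
    show "sets M = sigma_sets UNIV (Collect open)" "sets N = sigma_sets UNIV (Collect open)"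
      using sets by (simp_all add: borel_def)
  qed (auto simp: emeasure_eq)
qed

section \<open>The topology of the sequence space\<close>

lemma compact_UNIV_fun:
  assumes "compact (UNIV :: 'a::topological_space set)"
  shows "compact (UNIV :: ('i \<Rightarrow> 'a) set)"
proof -
  have "compact_space (product_topology (\<lambda>i::'i. euclidean :: 'a topology) UNIV)"
    unfolding compact_space_product_topology using assms by (simp add: compact_space_def)
  then show ?thesis
    by (simp add: euclidean_product_topology compact_space_def)
qed

lemma continuous_on_cons_seq:
  "continuous_on UNIV (\<lambda>p :: 'a::topological_space \<times> (nat \<Rightarrow> 'a). cons_seq (fst p) (snd p))"
proof (rule continuous_on_coordinatewise_then_product)
  fix i
  have "continuous_on UNIV (\<lambda>p :: 'a \<times> (nat \<Rightarrow> 'a). snd p k)" for k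
    by (rule continuous_on_compose2[OF continuous_on_product_coordinates continuous_on_snd[OF continuous_on_id]]) auto
  then show "continuous_on UNIV (\<lambda>p :: 'a \<times> (nat \<Rightarrow> 'a). cons_seq (fst p) (snd p) i)"
    by (cases i) (auto simp: cons_seq_def intro: continuous_on_fst continuous_on_id)
qed

text \<open>The letter split off is the last one, adjacent to \<open>x\<close>. It is the variable
  of the outermost integral in \<open>L ^^ Suc n\<close>, so inductions over iterates proceed in
  this form.\<close>

lemma prepend_Suc: "prepend (Suc n) a x = prepend n a (cons_seq (a n) x)"
proof
  fix k
  consider "k < n" | "k = n" | j where "k = Suc (n + j)"
    using less_iff_Suc_add by (metis linorder_neqE_nat)
  then show "prepend (Suc n) a x k = prepend n a (cons_seq (a n) x) k"
    by cases (simp_all add: prepend_def cons_seq_def Suc_diff_le)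
qed

lemma funpow_shift: "(shift ^^ n) x k = x (n + k)"
  by (induction n arbitrary: x k) (auto simp: shift_def)

lemma funpow_shift_prepend: "(shift ^^ n) (prepend n a x) = x"
  by (rule ext) (simp add: funpow_shift prepend_def)

lemma prepend_funpow_shift: "prepend n x ((shift ^^ n) x) = x"
  by (rule ext) (simp add: funpow_shift prepend_def)

section \<open>The metric \<open>dOmega\<close> and its agreement with the product topology\<close>

lemma dOmega_commute: "dOmega x y = dOmega y x"
  by (simp add: dOmega_def dist_commute)

lemma dOmega_self [simp]: "dOmega x x = 0"
  by (simp add: dOmega_def)

context
  assumes compact_UNIV: "compact (UNIV :: 'a::metric_space set)"
begin

lemma dist_bound:
  obtains D where "\<And>x y :: 'a. dist x y \<le> D"
  using compact_imp_bounded[OF compact_UNIV] unfolding bounded_two_points by auto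

lemma dOmega_term_bound:
  obtains D where "\<And>n and x y :: nat \<Rightarrow> 'a. norm ((1/2) ^ Suc n * dist (x n) (y n)) \<le> D * (1/2) ^ Suc n"
    and "summable (\<lambda>n. D * (1/2) ^ Suc n :: real)"
proof -
  obtain D where D: "\<And>x y :: 'a. dist x y \<le> D"
    by (rule dist_bound) blast
  have "norm ((1/2) ^ Suc n * dist (x n) (y n)) \<le> D * (1/2) ^ Suc n" for n and x y :: "nat \<Rightarrow> 'a"
    using D[of "x n" "y n"] by (simp add: mult.commute)
  then show ?thesis
    using that[of D] sums_mult[OF power_half_series, THEN sums_summable] by blast
qed

lemma summable_dOmega: "summable (\<lambda>n. (1/2) ^ Suc n * dist (x n) (y n :: 'a))"
proof -
  obtain D where D: "\<And>n and x y :: nat \<Rightarrow> 'a. norm ((1/2) ^ Suc n * dist (x n) (y n)) \<le> D * (1/2) ^ Suc n"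
    "summable (\<lambda>n. D * (1/2) ^ Suc n :: real)"
    by (rule dOmega_term_bound) blast
  show ?thesis
    by (rule summable_comparison_test'[OF D(2), of 0]) (rule D(1))
qed

lemma continuous_on_dOmega:
  "continuous_on UNIV (\<lambda>p :: (nat \<Rightarrow> 'a) \<times> (nat \<Rightarrow> 'a). dOmega (fst p) (snd p))"
proof -
  obtain D where D: "\<And>n and x y :: nat \<Rightarrow> 'a. norm ((1/2) ^ Suc n * dist (x n) (y n)) \<le> D * (1/2) ^ Suc n"
    "summable (\<lambda>n. D * (1/2) ^ Suc n :: real)"
    by (rule dOmega_term_bound) blast
  have "uniform_limit UNIV (\<lambda>n (p :: (nat \<Rightarrow> 'a) \<times> (nat \<Rightarrow> 'a)). \<Sum>i<n. (1/2) ^ Suc i * dist (fst p i) (snd p i))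
      (\<lambda>p. \<Sum>i. (1/2) ^ Suc i * dist (fst p i) (snd p i)) sequentially"
    by (rule Weierstrass_m_test[OF D])
  moreover have "continuous_on UNIV (\<lambda>p :: (nat \<Rightarrow> 'a) \<times> (nat \<Rightarrow> 'a). fst p i)"
    "continuous_on UNIV (\<lambda>p :: (nat \<Rightarrow> 'a) \<times> (nat \<Rightarrow> 'a). snd p i)" for i
    by (rule continuous_on_compose2[OF continuous_on_product_coordinates],
        auto intro: continuous_on_fst continuous_on_snd continuous_on_id)+
  then have "continuous_on UNIV (\<lambda>p :: (nat \<Rightarrow> 'a) \<times> (nat \<Rightarrow> 'a). \<Sum>i<n. (1/2) ^ Suc i * dist (fst p i) (snd p i))" for n
    by (intro continuous_intros)
  ultimately show ?thesis
    unfolding dOmega_def by (intro uniform_limit_theorem) (auto intro: always_eventually)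
qed

lemma continuous_on_dOmega_right: "continuous_on UNIV (dOmega (x :: nat \<Rightarrow> 'a))"
  using continuous_on_compose2[OF continuous_on_dOmega continuous_on_Pair[OF continuous_on_const continuous_on_id]]
  by simp

lemma open_dOmega_ball: "open {y :: nat \<Rightarrow> 'a. dOmega x y < e}"
  by (intro open_Collect_less continuous_on_dOmega_right continuous_on_const)

lemma dOmega_bound:
  obtains B where "0 < B" "\<And>x y :: nat \<Rightarrow> 'a. dOmega x y \<le> B"
proof -
  have "compact (UNIV :: ((nat \<Rightarrow> 'a) \<times> (nat \<Rightarrow> 'a)) set)"
    using compact_Times[OF compact_UNIV_fun compact_UNIV_fun] compact_UNIV by (metis UNIV_Times_UNIV)
  from bounded_continuous_on_compact_UNIV[OF this continuous_on_dOmega]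
  obtain B where "0 < B" "\<And>p :: (nat \<Rightarrow> 'a) \<times> (nat \<Rightarrow> 'a). \<bar>dOmega (fst p) (snd p)\<bar> \<le> B"
    by metis
  then show ?thesis
    using that[of B] by (metis abs_le_D1 fst_conv snd_conv)
qed

lemma dOmega_pos:
  assumes "x \<noteq> (y :: nat \<Rightarrow> 'a)"
  shows "0 < dOmega x y"
proof -
  obtain i where "x i \<noteq> y i"
    using assms by auto
  then show ?thesis
    unfolding dOmega_def by (intro suminf_pos2[OF summable_dOmega, of _ _ i]) auto
qed

text \<open>A common first letter contributes nothing and moves every other coordinate one place on,
  which halves its weight.\<close>

lemma dOmega_prepend: "dOmega (prepend n a x) (prepend n a y :: nat \<Rightarrow> 'a) = dOmega x y / 2 ^ n"
proof (induction n arbitrary: x y)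
  case 0
  then show ?case
    by (simp add: prepend_def)
next
  case (Suc n)
  have "dOmega (cons_seq b x) (cons_seq b y) = dOmega x y / 2" for b
  proof -
    have "dOmega (cons_seq b x) (cons_seq b y) =
        (\<Sum>n. (1/2) ^ Suc (Suc n) * dist (cons_seq b x (Suc n)) (cons_seq b y (Suc n)))"
      unfolding dOmega_def by (subst suminf_split_head[OF summable_dOmega]) (simp add: cons_seq_def)
    also have "\<dots> = (\<Sum>n. (1/2) * ((1/2) ^ Suc n * dist (x n) (y n)))"
      by (simp add: cons_seq_def)
    also have "\<dots> = (1/2) * dOmega x y"
      unfolding dOmega_def by (rule suminf_mult[OF summable_dOmega])
    finally show ?thesis
      by simp
  qed
  from this[of "a n"] show ?case
    by (simp add: prepend_Suc Suc.IH field_simps)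
qed

text \<open>The continuous function \<open>dOmega\<close> attains its minimum on \<open>K\<close>,
  and the minimum is positive off the diagonal. This yields both uniform continuity and the
  comparison of topologies.\<close>

lemma dOmega_separates_compact:
  assumes "compact K" and "\<And>x. (x, x) \<notin> K"
  obtains d where "0 < d" "\<And>x y :: nat \<Rightarrow> 'a. dOmega x y < d \<Longrightarrow> (x, y) \<notin> K"
proof (cases "K = {}")
  case True
  then show ?thesis
    using that[of 1] by simp
next
  case False
  obtain p where p: "p \<in> K" "\<And>q. q \<in> K \<Longrightarrow> dOmega (fst p) (snd p) \<le> dOmega (fst q) (snd q)"
    using continuous_attains_inf[OF assms(1) False continuous_on_subset[OF continuous_on_dOmega]] by auto
  have "fst p \<noteq> snd p"
    using p(1) assms(2) by (metis prod.collapse)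
  then have "0 < dOmega (fst p) (snd p)"
    by (rule dOmega_pos)
  then show ?thesis
    using that[of "dOmega (fst p) (snd p)"] p(2) by force
qed

lemma uniformly_continuous_dOmega:
  fixes \<phi> :: "(nat \<Rightarrow> 'a) \<Rightarrow> real"
  assumes cont: "continuous_on UNIV \<phi>" and e: "0 < e"
  obtains d where "0 < d" "\<And>x y. dOmega x y < d \<Longrightarrow> \<bar>\<phi> x - \<phi> y\<bar> < e"
proof -
  \<comment> \<open>The pairs violating the estimate form a compact set that misses the
    diagonal.\<close>
  let ?K = "{p. e \<le> \<bar>\<phi> (fst p) - \<phi> (snd p)\<bar>}"
  have c: "continuous_on UNIV (\<lambda>p. \<phi> (fst p))" "continuous_on UNIV (\<lambda>p. \<phi> (snd p))"
    by (rule continuous_on_compose2[OF cont], auto intro: continuous_on_fst continuous_on_snd continuous_on_id)+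
  have "closed ?K"
    by (intro closed_Collect_le continuous_intros c)
  moreover have "compact (UNIV :: ((nat \<Rightarrow> 'a) \<times> (nat \<Rightarrow> 'a)) set)"
    using compact_Times[OF compact_UNIV_fun compact_UNIV_fun] compact_UNIV by (metis UNIV_Times_UNIV)
  ultimately have "compact ?K"
    using compact_Int_closed by fastforce
  then obtain d where "0 < d" "\<And>x y. dOmega x y < d \<Longrightarrow> (x, y) \<notin> ?K"
    by (rule dOmega_separates_compact) (use e in auto)
  then show ?thesis
    using that[of d] by (auto simp: not_le)
qed

text \<open>Balls of \<open>dOmega\<close> are open in the product topology by continuity of
  \<open>dOmega\<close>; conversely, compactness keeps \<open>x\<close> at a positive distance from
  the closed set \<open>- U\<close>.\<close>

lemma Omega_open_iff_open: "Omega_open (U :: (nat \<Rightarrow> 'a) set) \<longleftrightarrow> open U"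
proof
  assume U: "Omega_open U"
  show "open U"
  proof (subst open_subopen, intro ballI)
    fix x assume "x \<in> U"
    then obtain e where "0 < e" "\<forall>y. dOmega x y < e \<longrightarrow> y \<in> U"
      using U unfolding Omega_open_def by blast
    then show "\<exists>T. open T \<and> x \<in> T \<and> T \<subseteq> U"
      using open_dOmega_ball[of x e] by (intro exI[of _ "{y. dOmega x y < e}"]) auto
  qed
next
  assume U: "open U"
  show "Omega_open U"
    unfolding Omega_open_def
  proof
    fix x assume x: "x \<in> U"
    have "compact (- U)"
      using compact_Int_closed[OF compact_UNIV_fun[OF compact_UNIV], of "- U"] U by auto
    then have "compact ({x} \<times> (- U))"
      by (intro compact_Times) auto
    then obtain d where "0 < d" "\<And>u y. dOmega u y < d \<Longrightarrow> (u, y) \<notin> {x} \<times> (- U)"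
      by (rule dOmega_separates_compact) (use x in auto)
    then show "\<exists>e>0. \<forall>y. dOmega x y < e \<longrightarrow> y \<in> U"
      by blast
  qed
qed

lemma Omega_cont_iff_continuous: "Omega_cont (\<phi> :: (nat \<Rightarrow> 'a) \<Rightarrow> real) \<longleftrightarrow> continuous_on UNIV \<phi>"
proof
  assume \<phi>: "Omega_cont \<phi>"
  have "\<forall>\<^sub>F y in at x. dist (\<phi> y) (\<phi> x) < e" if e: "0 < e" for x e
  proof -
    obtain d where d: "0 < d" "\<And>y. dOmega x y < d \<Longrightarrow> \<bar>\<phi> y - \<phi> x\<bar> < e"
      using \<phi> e unfolding Omega_cont_def by blast
    show ?thesis
      using open_dOmega_ball[of x d] d
      by (auto simp: eventually_at_topological dist_real_def intro!: exI[of _ "{y. dOmega x y < d}"])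
  qed
  then have "(\<phi> \<longlongrightarrow> \<phi> x) (at x)" for x
    by (intro tendstoI)
  then show "continuous_on UNIV \<phi>"
    by (simp add: continuous_on_def)
next
  assume \<phi>: "continuous_on UNIV \<phi>"
  show "Omega_cont \<phi>"
    unfolding Omega_cont_def
  proof (intro allI impI)
    fix x and e :: real assume "0 < e"
    then obtain d where "0 < d" "\<And>x y. dOmega x y < d \<Longrightarrow> \<bar>\<phi> x - \<phi> y\<bar> < e"
      using uniformly_continuous_dOmega[OF \<phi>] by metis
    then show "\<exists>d>0. \<forall>y. dOmega x y < d \<longrightarrow> \<bar>\<phi> y - \<phi> x\<bar> < e"
      by (metis abs_minus_commute)
  qed
qed

lemma sets_Omega_borel: "sets (Omega_borel :: (nat \<Rightarrow> 'a) measure) = sets borel"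
proof -
  have "Omega_open = (open :: (nat \<Rightarrow> 'a) set \<Rightarrow> bool)"
    using Omega_open_iff_open by blast
  then show ?thesis
    by (simp add: Omega_borel_def borel_def)
qed

end

section \<open>Iterates of the Ruelle operator\<close>

text \<open>A zero integral would make the nonempty open set \<open>{x. 0 < F x}\<close> a null
  set.\<close>

lemma integral_pos_of_full_support:
  fixes F :: "'b::topological_space \<Rightarrow> real"
  assumes sets: "sets \<mu> = sets borel"
    and supp: "\<And>U. open U \<Longrightarrow> U \<noteq> {} \<Longrightarrow> 0 < emeasure \<mu> U"
    and int: "integrable \<mu> F" and cont: "continuous_on UNIV F" and F0: "\<And>x. 0 \<le> F x" and pos: "0 < F b"
  shows "0 < (\<integral>x. F x \<partial>\<mu>)"
proof (rule ccontr)
  assume "\<not> 0 < (\<integral>x. F x \<partial>\<mu>)"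
  then have "(\<integral>x. F x \<partial>\<mu>) = 0"
    using integral_nonneg_AE[of F \<mu>] F0 by (metis AE_I2 order_le_less)
  then have "AE x in \<mu>. F x = 0"
    using integral_nonneg_eq_0_iff_AE[OF int] F0 by simp
  then have "AE x in \<mu>. \<not> 0 < F x"
    by (rule eventually_mono) simp
  then have "emeasure \<mu> {x. 0 < F x} = 0"
    using emeasure_eq_0_AE[of "\<lambda>x. 0 < F x" \<mu>] sets_eq_imp_space_eq[OF sets] by simp
  moreover have "open {x. 0 < F x}"
    by (intro open_Collect_less cont continuous_on_const)
  ultimately show False
    using supp[of "{x. 0 < F x}"] pos by auto
qed

locale normalized_potential =
  fixes \<mu> :: "'a::metric_space measure" and g :: "(nat \<Rightarrow> 'a) \<Rightarrow> real"
  assumes compact_M: "compact (UNIV :: 'a set)"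
    and mu_borel: "sets \<mu> = sets borel"
    and mu_prob: "prob_space \<mu>"
    and mu_supp: "\<And>U. open U \<Longrightarrow> U \<noteq> {} \<Longrightarrow> 0 < emeasure \<mu> U"
    and g_cont: "continuous_on UNIV g"
    and g_pos: "\<And>x. 0 < g x"
    and g_normalized: "\<And>x. (\<integral>a. g (cons_seq a x) \<partial>\<mu>) = 1"
    and walters: "weak_walters (\<lambda>x. ln (g x))"
begin

section \<open>Elementary properties of the operator and its iterates\<close>

abbreviation L :: "((nat \<Rightarrow> 'a) \<Rightarrow> real) \<Rightarrow> (nat \<Rightarrow> 'a) \<Rightarrow> real" where
  "L \<equiv> ruelle \<mu> (\<lambda>x. ln (g x))"

lemma L_eq: "L \<phi> x = (\<integral>a. g (cons_seq a x) * \<phi> (cons_seq a x) \<partial>\<mu>)"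
  by (simp add: ruelle_def g_pos)

lemma continuous_on_cons_seq_left: "continuous_on UNIV (\<lambda>a :: 'a. cons_seq a x)"
  using continuous_on_compose2[OF continuous_on_cons_seq continuous_on_Pair[OF continuous_on_id continuous_on_const]]
  by simp

lemma continuous_on_cons_seq_right: "continuous_on UNIV (cons_seq (a :: 'a))"
  using continuous_on_compose2[OF continuous_on_cons_seq continuous_on_Pair[OF continuous_on_const continuous_on_id]]
  by simp

lemma continuous_on_L_integrand:
  assumes "continuous_on UNIV \<phi>"
  shows "continuous_on UNIV (\<lambda>a. g (cons_seq a x) * \<phi> (cons_seq a x))"
  using continuous_on_compose2[OF g_cont continuous_on_cons_seq_left]
    continuous_on_compose2[OF assms continuous_on_cons_seq_left]
  by (intro continuous_on_mult) auto

lemma integrable_L_integrand: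
  assumes "continuous_on UNIV \<phi>"
  shows "integrable \<mu> (\<lambda>a. g (cons_seq a x) * \<phi> (cons_seq a x))"
  by (rule integrable_continuous_compact[OF compact_M continuous_on_L_integrand[OF assms] mu_prob mu_borel])

lemma compact_Omega: "compact (UNIV :: (nat \<Rightarrow> 'a) set)"
  by (rule compact_UNIV_fun[OF compact_M])

text \<open>Sequences detect continuity here, and along a sequence the integrands converge pointwise
  under the common bound \<open>B\<close>.\<close>

lemma continuous_on_L:
  assumes \<phi>: "continuous_on UNIV \<phi>"
  shows "continuous_on UNIV (L \<phi>)"
proof -
  interpret prob_space \<mu> by (rule mu_prob)
  let ?F = "\<lambda>x. g x * \<phi> x"
  have cont: "continuous_on UNIV ?F"
    by (intro continuous_intros g_cont \<phi>)
  obtain B where B: "\<And>x. \<bar>?F x\<bar> \<le> B"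
    using bounded_continuous_on_compact_UNIV[OF compact_Omega cont] by metis
  have "(\<lambda>n. L \<phi> (u n)) \<longlonglongrightarrow> L \<phi> x" if u: "u \<longlonglongrightarrow> x" for u x
    unfolding L_eq
  proof (rule integral_dominated_convergence[where w = "\<lambda>_. B"])
    show "(\<lambda>a. ?F (cons_seq a x)) \<in> borel_measurable \<mu>" for x
      using integrable_L_integrand[OF \<phi>] by (rule borel_measurable_integrable)
    show "(\<lambda>a. ?F (cons_seq a (u n))) \<in> borel_measurable \<mu>" for n
      using integrable_L_integrand[OF \<phi>] by (rule borel_measurable_integrable)
    have "(\<lambda>n. ?F (cons_seq a (u n))) \<longlonglongrightarrow> ?F (cons_seq a x)" for a
      using continuous_on_compose2[OF cont continuous_on_cons_seq_right[of a]] u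
      by (simp add: continuous_on_sequentially o_def)
    then show "AE a in \<mu>. (\<lambda>n. ?F (cons_seq a (u n))) \<longlonglongrightarrow> ?F (cons_seq a x)"
      by simp
  qed (auto simp: B)
  then show ?thesis
    by (simp add: continuous_on_sequentially o_def)
qed

lemma L_mono:
  assumes "continuous_on UNIV \<phi>" "continuous_on UNIV \<psi>" "\<And>x. \<phi> x \<le> \<psi> x"
  shows "L \<phi> x \<le> L \<psi> x"
  unfolding L_eq using assms g_pos
  by (intro integral_mono integrable_L_integrand mult_left_mono) (auto intro: less_imp_le)

lemma L_add:
  assumes "continuous_on UNIV \<phi>" "continuous_on UNIV \<psi>"
  shows "L (\<lambda>x. \<phi> x + \<psi> x) = (\<lambda>x. L \<phi> x + L \<psi> x)"
  unfolding L_eq distrib_left using integrable_L_integrand assms by (simp add: fun_eq_iff)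

lemma L_scale: "L (\<lambda>x. c * \<phi> x) = (\<lambda>x. c * L \<phi> x)"
  by (simp add: L_eq fun_eq_iff mult.left_commute[of _ c])

lemma L_const: "L (\<lambda>x. c) = (\<lambda>x. c)"
  by (simp add: L_eq fun_eq_iff g_normalized)

lemma continuous_on_iterate: "continuous_on UNIV \<phi> \<Longrightarrow> continuous_on UNIV ((L ^^ n) \<phi>)"
  by (induction n) (auto intro: continuous_on_L)

lemma iterate_mono:
  assumes "continuous_on UNIV \<phi>" "continuous_on UNIV \<psi>" "\<And>x. \<phi> x \<le> \<psi> x"
  shows "(L ^^ n) \<phi> x \<le> (L ^^ n) \<psi> x"
  using assms(3) by (induction n arbitrary: x) (auto intro!: L_mono continuous_on_iterate assms(1,2))

lemma iterate_add:
  assumes "continuous_on UNIV \<phi>" "continuous_on UNIV \<psi>"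
  shows "(L ^^ n) (\<lambda>x. \<phi> x + \<psi> x) = (\<lambda>x. (L ^^ n) \<phi> x + (L ^^ n) \<psi> x)"
  by (induction n) (auto simp: L_add continuous_on_iterate assms)

lemma iterate_scale: "(L ^^ n) (\<lambda>x. c * \<phi> x) = (\<lambda>x. c * (L ^^ n) \<phi> x)"
  by (induction n) (auto simp: L_scale)

lemma iterate_const: "(L ^^ n) (\<lambda>x. c) = (\<lambda>x. c)"
  by (induction n) (auto simp: L_const)

section \<open>Equicontinuity of the iterates\<close>

lemma birkhoff_sum_Suc_prepend:
  "birkhoff_sum (Suc n) f (prepend n a x) = birkhoff_sum n f (prepend n a x) + f x"
  by (simp add: birkhoff_sum_def funpow_shift_prepend)

text \<open>A comparison of the integrands of \<open>L\<^sup>n\<close> over words of length \<open>n\<close>, transferred to the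
  integrals one letter at a time so that the product measure on words is never needed.\<close>

lemma iterate_le_of_weights_le:
  assumes cont: "continuous_on UNIV \<phi>" "continuous_on UNIV \<psi>"
    and le: "\<And>a. exp (birkhoff_sum n (\<lambda>z. ln (g z)) (prepend n a x)) * \<phi> (prepend n a x)
          \<le> K * (exp (birkhoff_sum n (\<lambda>z. ln (g z)) (prepend n a y)) * \<psi> (prepend n a y))"
  shows "(L ^^ n) \<phi> x \<le> K * (L ^^ n) \<psi> y"
  using le
proof (induction n arbitrary: x y K)
  case 0
  then show ?case
    by (simp add: birkhoff_sum_def prepend_def)
next
  case (Suc n)
  let ?S = "\<lambda>n. birkhoff_sum n (\<lambda>z. ln (g z))"
  \<comment> \<open>With the last letter \<open>b\<close> fixed, the ratio of the factors
    \<open>g\<close> at the two points is absorbed into the constant; hence the induction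
    generalizes \<open>K\<close> along with \<open>x\<close> and \<open>y\<close>.\<close>
  have step: "g (cons_seq b x) * (L ^^ n) \<phi> (cons_seq b x)
      \<le> K * (g (cons_seq b y) * (L ^^ n) \<psi> (cons_seq b y))" for b
  proof -
    let ?x = "cons_seq b x" and ?y = "cons_seq b y"
    have "exp (?S n (prepend n a ?x)) * \<phi> (prepend n a ?x)
        \<le> (K * g ?y / g ?x) * (exp (?S n (prepend n a ?y)) * \<psi> (prepend n a ?y))" for a
    proof -
      \<comment> \<open>Overwriting position \<open>n\<close> makes \<open>b\<close> the last letter
        and leaves untouched the first \<open>n\<close> letters, all that \<open>prepend n\<close>
        reads.\<close>
      let ?a = "a(n := b)"
      have pre: "prepend (Suc n) ?a z = prepend n a (cons_seq b z)" for z
        unfolding prepend_Suc by (simp add: prepend_def fun_eq_iff)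
      have S: "exp (?S (Suc n) (prepend n a z)) = exp (?S n (prepend n a z)) * g z" for z
        by (simp add: birkhoff_sum_Suc_prepend exp_add g_pos)
      show ?thesis
        using Suc.prems[of ?a] g_pos[of ?x] unfolding pre S by (simp add: field_simps)
    qed
    from Suc.IH[OF this] show ?thesis
      using g_pos[of ?x] by (simp add: field_simps)
  qed
  have "L ((L ^^ n) \<phi>) x \<le> (\<integral>b. K * (g (cons_seq b y) * (L ^^ n) \<psi> (cons_seq b y)) \<partial>\<mu>)"
    unfolding L_eq[of "(L ^^ n) \<phi>"]
    by (intro integral_mono integrable_mult_right integrable_L_integrand continuous_on_iterate cont step)
  then show ?case
    by (simp add: L_eq[of "(L ^^ n) \<psi>"])
qed

lemma weights_le:
  assumes "\<bar>C_f (\<lambda>z. ln (g z)) x y\<bar> < ereal \<eta>"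
  shows "exp (birkhoff_sum n (\<lambda>z. ln (g z)) (prepend n a x))
    \<le> exp \<eta> * exp (birkhoff_sum n (\<lambda>z. ln (g z)) (prepend n a y))"
\<comment> \<open>The supremum in \<open>C_f\<close> starts at length one. For the empty word both
  sums are zero, and \<open>\<eta>\<close> is positive.\<close>
proof (cases "n = 0")
  case True
  have "0 < ereal \<eta>"
    using assms by (metis abs_ereal_pos order_le_less_trans)
  then show ?thesis
    using True by (simp add: birkhoff_sum_def)
next
  case False
  let ?S = "birkhoff_sum n (\<lambda>z. ln (g z))"
  have "ereal (?S (prepend n a x) - ?S (prepend n a y)) \<le> C_f (\<lambda>z. ln (g z)) x y"
    unfolding C_f_def using False by (intro SUP_upper2[of n] SUP_upper2[of a]) auto
  also have "\<dots> \<le> \<bar>C_f (\<lambda>z. ln (g z)) x y\<bar>"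
    by (cases "C_f (\<lambda>z. ln (g z)) x y") auto
  also have "\<dots> < ereal \<eta>"
    by fact
  finally have "?S (prepend n a x) \<le> \<eta> + ?S (prepend n a y)"
    by simp
  then show ?thesis
    by (simp flip: exp_add)
qed

text \<open>The weak Walters condition bounds the ratio of the weights of one word before
  \<open>x\<close> and before \<open>y\<close> by \<open>1 + t\<close>, uniformly in the word and
  its length. Prepending does not increase distances, so the values of \<open>\<phi>\<close> stay
  close as well, and \<open>iterate_le_of_weights_le\<close> passes the comparison to the
  iterates.\<close>

lemma equicontinuous_iterates:
  assumes cont: "continuous_on UNIV \<phi>" and e: "0 < e"
  obtains d where "0 < d" "\<And>n x y. dOmega x y < d \<Longrightarrow> \<bar>(L ^^ n) \<phi> x - (L ^^ n) \<phi> y\<bar> < e"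
proof -
  obtain B where B: "0 < B" "\<And>x. \<bar>\<phi> x\<bar> \<le> B"
    using bounded_continuous_on_compact_UNIV[OF compact_Omega cont] by metis
  \<comment> \<open>The relative error \<open>t\<close> acts on values of size at most
    \<open>2 * B + e / 4\<close>. This choice keeps each of its two contributions below
    \<open>e / 4\<close>, so with the error from \<open>\<phi>\<close> the total is at most
    \<open>3 * e / 4\<close>.\<close>
  define t where "t = min 1 (e / (8 * B))"
  have t: "0 < t" "t \<le> 1" "t * (2 * B) \<le> e / 4"
    using B(1) e by (auto simp: t_def min_def field_simps)
  have "0 < ln (1 + t)"
    using t by simp
  then obtain d1 where d1: "0 < d1"
    "\<And>x y. dOmega x y < d1 \<Longrightarrow> \<bar>C_f (\<lambda>z. ln (g z)) x y\<bar> < ereal (ln (1 + t))"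
    using walters unfolding weak_walters_def by blast
  have "0 < e / 4"
    using e by simp
  then obtain d2 where d2: "0 < d2" "\<And>x y. dOmega x y < d2 \<Longrightarrow> \<bar>\<phi> x - \<phi> y\<bar> < e / 4"
    using uniformly_continuous_dOmega[OF compact_M cont] by metis
  have *: "(L ^^ n) \<phi> x - (L ^^ n) \<phi> y < e" if d: "dOmega x y < min d1 d2" for n x y
  proof -
    let ?S = "birkhoff_sum n (\<lambda>z. ln (g z))"
    \<comment> \<open>Adding \<open>B\<close> makes the values nonnegative, so that inequalities of
      weights and of values can be multiplied; the extra \<open>e / 4\<close> absorbs the variation
      of \<open>\<phi>\<close>.\<close>
    let ?p = "\<lambda>z. \<phi> z + B" and ?q = "\<lambda>z. \<phi> z + (B + e / 4)"
    have contp: "continuous_on UNIV ?p" and contq: "continuous_on UNIV ?q"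
      by (intro continuous_intros cont)+
    have "(L ^^ n) ?p x \<le> (1 + t) * (L ^^ n) ?q y"
    proof (rule iterate_le_of_weights_le[OF contp contq])
      fix a
      have "dOmega x y / 2 ^ n < d2"
      proof (cases "dOmega x y \<le> 0")
        case True
        then have "dOmega x y / 2 ^ n \<le> 0"
          by (simp add: divide_nonpos_pos)
        then show ?thesis
          using d2(1) by simp
      next
        case False
        then have "dOmega x y / 2 ^ n \<le> dOmega x y"
          by (simp add: field_simps)
        then show ?thesis
          using d by simp
      qed
      then have "\<bar>\<phi> (prepend n a x) - \<phi> (prepend n a y)\<bar> < e / 4"
        by (intro d2(2)) (simp add: dOmega_prepend[OF compact_M])
      then have "?p (prepend n a x) \<le> ?q (prepend n a y)"
        by linarith
      moreover have "exp (?S (prepend n a x)) \<le> (1 + t) * exp (?S (prepend n a y))"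
        using weights_le[OF d1(2), of x y n a] d t(1) by simp
      moreover have "0 \<le> ?p (prepend n a x)"
        using B(2)[of "prepend n a x"] by linarith
      ultimately have "exp (?S (prepend n a x)) * ?p (prepend n a x)
          \<le> ((1 + t) * exp (?S (prepend n a y))) * ?q (prepend n a y)"
        using t(1) by (intro mult_mono) auto
      then show "exp (?S (prepend n a x)) * ?p (prepend n a x)
          \<le> (1 + t) * (exp (?S (prepend n a y)) * ?q (prepend n a y))"
        by (simp only: mult.assoc)
    qed
    then have le: "(L ^^ n) \<phi> x + B \<le> (1 + t) * ((L ^^ n) \<phi> y + B + e / 4)"
      using iterate_add[OF cont continuous_on_const] by (simp add: iterate_const add.assoc)
    have "(L ^^ n) \<phi> y \<le> (L ^^ n) (\<lambda>x. B) y"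
      using B(2) by (intro iterate_mono cont continuous_on_const) (auto simp: abs_le_iff)
    then have "(L ^^ n) \<phi> y + B \<le> 2 * B"
      by (simp add: iterate_const)
    then have "t * ((L ^^ n) \<phi> y + B) \<le> t * (2 * B)"
      using t(1) by (intro mult_left_mono) auto
    then have "t * ((L ^^ n) \<phi> y + B) \<le> e / 4"
      using t(3) by linarith
    moreover have "t * (e / 4) \<le> e / 4"
      using t e by simp
    moreover have "(1 + t) * ((L ^^ n) \<phi> y + B + e / 4)
        = (L ^^ n) \<phi> y + B + e / 4 + t * ((L ^^ n) \<phi> y + B) + t * (e / 4)"
      by (simp add: algebra_simps)
    ultimately show ?thesis
      using le e by linarith
  qed
  have "\<bar>(L ^^ n) \<phi> x - (L ^^ n) \<phi> y\<bar> < e" if "dOmega x y < min d1 d2" for n x y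
    using *[OF that, of n] *[of y x n] that dOmega_commute[of x y] by (simp add: abs_less_iff)
  then show ?thesis
    using that[of "min d1 d2"] d1(1) d2(1) by simp
qed

text \<open>Positivity at one preimage spreads by continuity to an open set of letters, which full
  support of \<open>\<mu>\<close> turns into a positive integral; this is repeated letter by
  letter.\<close>

lemma iterate_pos:
  assumes cont: "continuous_on UNIV h" and h0: "\<And>x. 0 \<le> h x" and pos: "0 < h (prepend k a x)"
  shows "0 < (L ^^ k) h x"
  using pos
proof (induction k arbitrary: x)
  case 0
  then show ?case
    by (simp add: prepend_def)
next
  case (Suc k)
  have nonneg: "0 \<le> (L ^^ k) h z" for z
    using iterate_mono[OF continuous_on_const cont h0, of k z] by (simp add: iterate_const)
  have "0 < (L ^^ k) h (cons_seq (a k) x)"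
    using Suc by (simp add: prepend_Suc)
  then have "0 < (\<integral>b. g (cons_seq b x) * (L ^^ k) h (cons_seq b x) \<partial>\<mu>)"
    using g_pos nonneg
    by (intro integral_pos_of_full_support[OF mu_borel mu_supp, where b = "a k"]
        integrable_L_integrand continuous_on_L_integrand continuous_on_iterate cont)
      (auto intro: mult_nonneg_nonneg less_imp_le)
  then show ?case
    by (simp add: L_eq[of "(L ^^ k) h"])
qed

section \<open>Extrema of the iterates and decay of the oscillation\<close>

definition upper :: "((nat \<Rightarrow> 'a) \<Rightarrow> real) \<Rightarrow> nat \<Rightarrow> real" where
  "upper \<phi> n = (SUP x. (L ^^ n) \<phi> x)"

definition lower :: "((nat \<Rightarrow> 'a) \<Rightarrow> real) \<Rightarrow> nat \<Rightarrow> real" where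
  "lower \<phi> n = (INF x. (L ^^ n) \<phi> x)"

context
  fixes \<phi> :: "(nat \<Rightarrow> 'a) \<Rightarrow> real"
  assumes cont: "continuous_on UNIV \<phi>"
begin

lemma iterate_le_upper: "(L ^^ n) \<phi> x \<le> upper \<phi> n"
proof -
  have "bounded (range ((L ^^ n) \<phi>))"
    by (intro compact_imp_bounded compact_continuous_image continuous_on_iterate cont compact_Omega)
  then show ?thesis
    unfolding upper_def by (intro cSUP_upper bounded_imp_bdd_above) auto
qed

lemma lower_le_iterate: "lower \<phi> n \<le> (L ^^ n) \<phi> x"
proof -
  have "bounded (range ((L ^^ n) \<phi>))"
    by (intro compact_imp_bounded compact_continuous_image continuous_on_iterate cont compact_Omega)
  then show ?thesis
    unfolding lower_def by (intro cINF_lower bounded_imp_bdd_below) auto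
qed

lemma upper_le: "(\<And>x. (L ^^ n) \<phi> x \<le> c) \<Longrightarrow> upper \<phi> n \<le> c"
  unfolding upper_def by (intro cSUP_least) auto

lemma le_lower: "(\<And>x. c \<le> (L ^^ n) \<phi> x) \<Longrightarrow> c \<le> lower \<phi> n"
  unfolding lower_def by (intro cINF_greatest) auto

lemma lower_attained: obtains v where "(L ^^ n) \<phi> v = lower \<phi> n"
proof -
  obtain v where "\<And>x. (L ^^ n) \<phi> v \<le> (L ^^ n) \<phi> x"
    using continuous_attains_inf[OF compact_Omega _ continuous_on_iterate[OF cont]] by auto
  then show ?thesis
    using that[of v] le_lower lower_le_iterate antisym by blast
qed

lemma upper_antimono: "decseq (upper \<phi>)"
proof (rule decseq_SucI, rule upper_le)
  fix n x
  show "(L ^^ Suc n) \<phi> x \<le> upper \<phi> n"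
    using L_mono[OF continuous_on_iterate[OF cont] continuous_on_const iterate_le_upper, of n x]
    by (simp add: L_const)
qed

lemma lower_mono: "incseq (lower \<phi>)"
proof (rule incseq_SucI, rule le_lower)
  fix n x
  show "lower \<phi> n \<le> (L ^^ Suc n) \<phi> x"
    using L_mono[OF continuous_on_const continuous_on_iterate[OF cont] lower_le_iterate, of n x]
    by (simp add: L_const)
qed

text \<open>By equicontinuity every iterate is close to its minimum on one of finitely many fixed
  balls, and \<open>L\<^sup>k\<close> moves a definite amount of the mass of each of these balls to every point.\<close>

lemma oscillation_contraction:
  assumes e: "0 < e"
  obtains k c where "0 < c" "\<And>n. e \<le> upper \<phi> n - lower \<phi> n \<Longrightarrow>
    upper \<phi> (n + k) - lower \<phi> (n + k) \<le> upper \<phi> n - lower \<phi> n - c * (upper \<phi> n - lower \<phi> n - e)"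
proof -
  obtain d where d: "0 < d" "\<And>n x y. dOmega x y < d \<Longrightarrow> \<bar>(L ^^ n) \<phi> x - (L ^^ n) \<phi> y\<bar> < e / 2"
    using equicontinuous_iterates[OF cont, of "e / 2"] e by (metis half_gt_zero)
  have "(UNIV :: (nat \<Rightarrow> 'a) set) \<subseteq> (\<Union>w\<in>UNIV. {u. dOmega w u < d})"
    using d(1) by auto
  then obtain W :: "(nat \<Rightarrow> 'a) set" where W: "finite W" "UNIV \<subseteq> (\<Union>w\<in>W. {u. dOmega w u < d})"
    using compactE_image[OF compact_Omega, of UNIV "\<lambda>w. {u. dOmega w u < d}"]
      open_dOmega_ball[OF compact_M] by metis
  obtain B where B: "0 < B" "\<And>x y :: nat \<Rightarrow> 'a. dOmega x y \<le> B"
    using dOmega_bound[OF compact_M] by metis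
  \<comment> \<open>With this \<open>k\<close>, the first \<open>k\<close> letters of
    \<open>w\<close> put before any point give a point within \<open>d\<close> of \<open>w\<close>;
    the choice depends neither on \<open>w\<close> nor on \<open>n\<close>.\<close>
  obtain k where "B / d < 2 ^ k"
    using real_arch_pow[of 2 "B / d"] by auto
  then have k: "B / 2 ^ k < d"
    using d(1) by (simp add: field_simps)
  \<comment> \<open>A tent function with values in the unit interval, positive exactly on the ball
    of radius \<open>d\<close> around \<open>w\<close>.\<close>
  define h where "h w u = max 0 (1 - dOmega w u / d)" for w u :: "nat \<Rightarrow> 'a"
  have conth: "continuous_on UNIV (h w)" for w
    unfolding h_def by (intro continuous_intros continuous_on_dOmega_right[OF compact_M]) (use d in auto)
  have h0: "0 \<le> h w u" for w u
    by (simp add: h_def)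
  have "\<exists>c>0. \<forall>x. c \<le> (L ^^ k) (h w) x" for w
  proof -
    obtain x0 where x0: "\<And>x. (L ^^ k) (h w) x0 \<le> (L ^^ k) (h w) x"
      using continuous_attains_inf[OF compact_Omega _ continuous_on_iterate[OF conth], of k w] by auto
    have "dOmega w (prepend k w x0) = dOmega ((shift ^^ k) w) x0 / 2 ^ k"
      using dOmega_prepend[OF compact_M, of k w "(shift ^^ k) w" x0] by (simp add: prepend_funpow_shift)
    also have "\<dots> \<le> B / 2 ^ k"
      using B(2) by (intro divide_right_mono) auto
    finally have "0 < h w (prepend k w x0)"
      using k d(1) by (simp add: h_def)
    then have "0 < (L ^^ k) (h w) x0"
      using iterate_pos[OF conth h0] by blast
    with x0 show ?thesis
      by blast
  qed
  then obtain C where C: "\<And>w. 0 < C w" "\<And>w x. C w \<le> (L ^^ k) (h w) x"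
    by metis
  define c where "c = Min (insert 1 (C ` W))"
  have c: "0 < c"
    unfolding c_def using W(1) C(1) by (subst Min_gr_iff) auto
  have cC: "c \<le> C w" if "w \<in> W" for w
    unfolding c_def using W(1) that by (intro Min_le) auto
  have "upper \<phi> (n + k) - lower \<phi> (n + k) \<le> upper \<phi> n - lower \<phi> n - c * (upper \<phi> n - lower \<phi> n - e)"
    if n: "e \<le> upper \<phi> n - lower \<phi> n" for n
  proof -
    let ?M = "upper \<phi> n" and ?r = "upper \<phi> n - lower \<phi> n - e"
    obtain v where v: "(L ^^ n) \<phi> v = lower \<phi> n"
      by (rule lower_attained)
    obtain w where w: "w \<in> W" "dOmega w v < d"
      using W(2) by auto
    \<comment> \<open>The ball around \<open>w\<close> contains the minimum point \<open>v\<close>,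
      so two steps of size \<open>e / 2\<close> keep the iterate below
      \<open>lower \<phi> n + e = ?M - ?r\<close> on it. The tent removes at most \<open>?r\<close>
      there and nothing elsewhere.\<close>
    have le: "(L ^^ n) \<phi> u \<le> ?M + (- ?r) * h w u" for u
    proof (cases "dOmega w u < d")
      case True
      have "(L ^^ n) \<phi> u \<le> lower \<phi> n + e"
        using d(2)[OF True, of n] d(2)[OF w(2), of n] v by linarith
      moreover have "- (?r * 1) \<le> - (?r * h w u)"
        using True n d(1) dOmega_pos[OF compact_M, of w u]
        by (intro le_imp_neg_le mult_left_mono) (cases "w = u"; auto simp: h_def)+
      ultimately show ?thesis
        unfolding mult_minus_left mult_1_right by linarith
    next
      case False
      then have "h w u = 0"
        using d(1) by (simp add: h_def)
      then show ?thesis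
        using iterate_le_upper[of n u] by simp
    qed
    have "(L ^^ (n + k)) \<phi> x \<le> ?M - c * ?r" for x
    proof -
      have "(L ^^ (n + k)) \<phi> x = (L ^^ k) ((L ^^ n) \<phi>) x"
        by (simp add: add.commute[of n k] funpow_add)
      also have "\<dots> \<le> (L ^^ k) (\<lambda>u. ?M + (- ?r) * h w u) x"
        by (intro iterate_mono continuous_on_iterate cont le continuous_intros conth)
      also have "\<dots> = ?M + (- ?r) * (L ^^ k) (h w) x"
        using iterate_add[OF continuous_on_const continuous_on_mult[OF continuous_on_const conth], of k ?M "- ?r" w]
        by (simp only: iterate_const iterate_scale)
      also have "\<dots> \<le> ?M - c * ?r"
        using mult_left_mono[of c "(L ^^ k) (h w) x" ?r] n cC[OF w(1)] C(2)[of w x]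
        unfolding mult_minus_left mult.commute[of c] by linarith
      finally show ?thesis .
    qed
    then have "upper \<phi> (n + k) \<le> ?M - c * ?r"
      by (rule upper_le)
    moreover have "lower \<phi> n \<le> lower \<phi> (n + k)"
      using lower_mono by (simp add: incseq_def)
    ultimately show ?thesis
      by linarith
  qed
  with c show ?thesis
    using that by blast
qed

text \<open>The oscillation decreases to some \<open>l\<close>. If \<open>l\<close> were positive,
  the contraction with \<open>e = l / 2\<close> would pass to the limit as
  \<open>l \<le> l - c * (l - e)\<close>, which is impossible.\<close>

lemma oscillation_tendsto_zero: "(\<lambda>n. upper \<phi> n - lower \<phi> n) \<longlonglongrightarrow> 0"
proof -
  let ?o = "\<lambda>n. upper \<phi> n - lower \<phi> n"
  have o0: "0 \<le> ?o n" for n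
    using iterate_le_upper[of n undefined] lower_le_iterate[of n undefined] by simp
  have dec: "decseq ?o"
    using upper_antimono lower_mono by (auto simp: decseq_def incseq_def intro: diff_mono)
  obtain l where l: "?o \<longlonglongrightarrow> l" "\<And>n. l \<le> ?o n"
    using decseq_convergent[OF dec, of 0] o0 by auto
  have "0 \<le> l"
    by (rule LIMSEQ_le_const[OF l(1)]) (use o0 in auto)
  moreover have "\<not> 0 < l"
  proof
    assume "0 < l"
    define e where "e = l / 2"
    have e: "0 < e" "e < l"
      using \<open>0 < l\<close> by (auto simp: e_def)
    obtain k c where c: "0 < c" "\<And>n. e \<le> ?o n \<Longrightarrow> ?o (n + k) \<le> ?o n - c * (?o n - e)"
      by (rule oscillation_contraction[OF e(1)]) blast
    have "e \<le> ?o n" for n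
      using l(2)[of n] e by simp
    then have "?o (n + k) \<le> ?o n - c * (?o n - e)" for n
      by (rule c(2))
    moreover have "(\<lambda>n. ?o (n + k)) \<longlonglongrightarrow> l"
      by (rule LIMSEQ_ignore_initial_segment[OF l(1)])
    moreover have "(\<lambda>n. ?o n - c * (?o n - e)) \<longlonglongrightarrow> l - c * (l - e)"
      by (intro tendsto_intros l(1))
    ultimately have "l \<le> l - c * (l - e)"
      by (intro LIMSEQ_le) auto
    moreover have "0 < c * (l - e)"
      using c(1) e by simp
    ultimately show False
      by simp
  qed
  ultimately show ?thesis
    using l(1) by simp
qed

text \<open>The limit of \<open>upper \<phi>\<close> lies between \<open>lower \<phi> n\<close> and
  \<open>upper \<phi> n\<close> for every \<open>n\<close>, so each iterate differs from it by at
  most the oscillation, at all points at once.\<close>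

lemma iterates_uniformly_convergent:
  obtains c where "\<And>e. 0 < e \<Longrightarrow> \<exists>N. \<forall>n\<ge>N. \<forall>x. \<bar>(L ^^ n) \<phi> x - c\<bar> < e"
proof -
  have le: "lower \<phi> m \<le> upper \<phi> n" for m n
  proof -
    have "lower \<phi> m \<le> lower \<phi> (max m n)" "upper \<phi> (max m n) \<le> upper \<phi> n"
      using lower_mono upper_antimono by (auto simp: incseq_def decseq_def)
    then show ?thesis
      using iterate_le_upper[of "max m n" undefined] lower_le_iterate[of "max m n" undefined] by linarith
  qed
  obtain c where c: "upper \<phi> \<longlonglongrightarrow> c" "\<And>n. c \<le> upper \<phi> n"
    using decseq_convergent[OF upper_antimono, of "lower \<phi> 0"] le by auto
  have cl: "lower \<phi> n \<le> c" for n
    by (rule LIMSEQ_le_const[OF c(1)]) (use le in auto)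
  have "\<exists>N. \<forall>n\<ge>N. \<forall>x. \<bar>(L ^^ n) \<phi> x - c\<bar> < e" if e: "0 < e" for e
  proof -
    obtain N where N: "\<And>n. N \<le> n \<Longrightarrow> upper \<phi> n - lower \<phi> n < e"
      using LIMSEQ_D[OF oscillation_tendsto_zero e] by (auto simp: abs_less_iff)
    have "\<bar>(L ^^ n) \<phi> x - c\<bar> < e" if "N \<le> n" for n x
      using N[OF that] iterate_le_upper[of n x] lower_le_iterate[of n x] c(2)[of n] cl[of n] by linarith
    then show ?thesis
      by blast
  qed
  then show ?thesis
    using that by blast
qed

end

section \<open>The limit functional and its invariant measure\<close>

text \<open>The base point \<open>undefined\<close> is arbitrary: for continuous
  \<open>\<phi>\<close> the limit is the same at every point.\<close>

definition limit_functional :: "((nat \<Rightarrow> 'a) \<Rightarrow> real) \<Rightarrow> real" where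
  "limit_functional \<phi> = lim (\<lambda>n. (L ^^ n) \<phi> undefined)"

lemma limit_functional_uniform:
  assumes cont: "continuous_on UNIV \<phi>" and e: "0 < e"
  shows "\<exists>N. \<forall>n\<ge>N. \<forall>x. \<bar>(L ^^ n) \<phi> x - limit_functional \<phi>\<bar> < e"
proof -
  obtain c where c: "\<And>e. 0 < e \<Longrightarrow> \<exists>N. \<forall>n\<ge>N. \<forall>x. \<bar>(L ^^ n) \<phi> x - c\<bar> < e"
    by (rule iterates_uniformly_convergent[OF cont]) blast
  have "(\<lambda>n. (L ^^ n) \<phi> undefined) \<longlonglongrightarrow> c"
    using c unfolding LIMSEQ_iff real_norm_def by blast
  then have "limit_functional \<phi> = c"
    unfolding limit_functional_def by (rule limI)
  then show ?thesis
    using c[OF e] by simp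
qed

lemma limit_functional_tendsto:
  assumes "continuous_on UNIV \<phi>"
  shows "(\<lambda>n. (L ^^ n) \<phi> x) \<longlonglongrightarrow> limit_functional \<phi>"
  using limit_functional_uniform[OF assms] unfolding LIMSEQ_iff real_norm_def by blast

text \<open>The locale's metric is the library's metric on \<open>nat \<Rightarrow> 'a\<close>, not
  \<open>dOmega\<close>. Both induce the product topology, so continuity and Borel sets have the
  same meaning.\<close>

sublocale limit: normalized_positive_functional limit_functional
proof
  show "compact (UNIV :: (nat \<Rightarrow> 'a) set)"
    by (rule compact_Omega)
next
  fix \<phi> \<psi> :: "(nat \<Rightarrow> 'a) \<Rightarrow> real"
  assume c: "continuous_on UNIV \<phi>" "continuous_on UNIV \<psi>"
  have "(\<lambda>n. (L ^^ n) (\<lambda>x. \<phi> x + \<psi> x) undefined) \<longlonglongrightarrow> limit_functional \<phi> + limit_functional \<psi>"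
    unfolding iterate_add[OF c] by (intro tendsto_add limit_functional_tendsto c)
  then show "limit_functional (\<lambda>x. \<phi> x + \<psi> x) = limit_functional \<phi> + limit_functional \<psi>"
    by (rule LIMSEQ_unique[OF limit_functional_tendsto, rotated]) (intro continuous_intros c)
  show "limit_functional \<phi> \<le> limit_functional \<psi>" if "\<And>x. \<phi> x \<le> \<psi> x"
    using iterate_mono[OF c that]
    by (intro LIMSEQ_le[OF limit_functional_tendsto limit_functional_tendsto] c) auto
next
  fix \<phi> :: "(nat \<Rightarrow> 'a) \<Rightarrow> real" and r
  assume c: "continuous_on UNIV \<phi>"
  have "(\<lambda>n. (L ^^ n) (\<lambda>x. r * \<phi> x) undefined) \<longlonglongrightarrow> r * limit_functional \<phi>"
    unfolding iterate_scale by (intro tendsto_mult_left limit_functional_tendsto c)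
  then show "limit_functional (\<lambda>x. r * \<phi> x) = r * limit_functional \<phi>"
    by (rule LIMSEQ_unique[OF limit_functional_tendsto, rotated]) (intro continuous_intros c)
next
  show "limit_functional (\<lambda>x. 1) = 1"
    using limit_functional_tendsto[of "\<lambda>x. 1"] by (simp add: iterate_const LIMSEQ_const_iff)
qed

text \<open>Iterating from \<open>L \<phi>\<close> only shifts the sequence of iterates by one; this
  gives \<open>dual_fixed\<close> for the representing measure.\<close>

lemma limit_functional_L:
  assumes "continuous_on UNIV \<phi>"
  shows "limit_functional (L \<phi>) = limit_functional \<phi>"
proof (rule LIMSEQ_unique[OF limit_functional_tendsto[OF continuous_on_L[OF assms]]])
  show "(\<lambda>n. (L ^^ n) (L \<phi>) undefined) \<longlonglongrightarrow> limit_functional \<phi>"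
    using LIMSEQ_Suc[OF limit_functional_tendsto[OF assms]] by (simp add: funpow_swap1)
qed

text \<open>Invariance makes the integral of \<open>(L ^^ n) \<phi>\<close> independent of
  \<open>n\<close>, while dominated convergence sends it to the integral of a constant over a
  probability space.\<close>

lemma integral_eq_limit_functional:
  assumes \<nu>: "prob_space \<nu>" "sets \<nu> = sets borel"
    and fixed: "\<And>\<phi>. continuous_on UNIV \<phi> \<Longrightarrow> (\<integral>x. L \<phi> x \<partial>\<nu>) = (\<integral>x. \<phi> x \<partial>\<nu>)"
    and cont: "continuous_on UNIV \<phi>"
  shows "(\<integral>x. \<phi> x \<partial>\<nu>) = limit_functional \<phi>"
proof -
  interpret prob_space \<nu> by fact
  have int: "integrable \<nu> \<psi>" if "continuous_on UNIV \<psi>" for \<psi> :: "(nat \<Rightarrow> 'a) \<Rightarrow> real"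
    by (rule integrable_continuous_compact[OF compact_Omega that \<nu>])
  have inv: "(\<integral>x. (L ^^ n) \<phi> x \<partial>\<nu>) = (\<integral>x. \<phi> x \<partial>\<nu>)" for n
    by (induction n) (simp_all add: fixed continuous_on_iterate cont)
  obtain B where B: "\<And>x. \<bar>\<phi> x\<bar> \<le> B"
    using bounded_continuous_on_compact_UNIV[OF compact_Omega cont] by metis
  have bound: "\<bar>(L ^^ n) \<phi> x\<bar> \<le> B" for n x
    using iterate_mono[OF cont continuous_on_const, of B n x]
      iterate_mono[OF continuous_on_const cont, of "- B" n x] B
    by (simp add: iterate_const abs_le_iff minus_le_iff)
  have "(\<lambda>n. \<integral>x. (L ^^ n) \<phi> x \<partial>\<nu>) \<longlonglongrightarrow> (\<integral>x. limit_functional \<phi> \<partial>\<nu>)"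
    by (rule integral_dominated_convergence[where w = "\<lambda>_. B"])
      (auto simp: bound limit_functional_tendsto cont intro!: borel_measurable_integrable int continuous_on_iterate)
  then show ?thesis
    by (simp add: inv LIMSEQ_const_iff prob_space)
qed

end

theorem mainTheorem7:
  fixes \<mu> :: "'a::metric_space measure"
    and g :: "(nat \<Rightarrow> 'a) \<Rightarrow> real"
  assumes compact_M: "compact (UNIV :: 'a set)"
    and mu_borel: "sets \<mu> = sets borel"
    and mu_prob: "prob_space \<mu>"
    and mu_supp: "\<forall>x U. open U \<and> x \<in> U \<longrightarrow> emeasure \<mu> U > 0"
    and g_G0: "G0 \<mu> g"
    and walters: "weak_walters (\<lambda>x. ln (g x))"
  shows "\<exists>\<nu> :: (nat \<Rightarrow> 'a) measure.
           sets \<nu> = sets Omega_borel \<and> prob_space \<nu> \<and>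
           (\<forall>\<phi>. Omega_cont \<phi> \<longrightarrow>
              (\<forall>e>0. \<exists>N. \<forall>n\<ge>N. \<forall>x.
                 \<bar>((ruelle \<mu> (\<lambda>y. ln (g y))) ^^ n) \<phi> x - (\<integral>y. \<phi> y \<partial>\<nu>)\<bar> < e)) \<and>
           dual_fixed \<mu> (\<lambda>y. ln (g y)) \<nu> \<and>
           (\<forall>\<nu>' :: (nat \<Rightarrow> 'a) measure.
              sets \<nu>' = sets Omega_borel \<and> prob_space \<nu>' \<and>
              dual_fixed \<mu> (\<lambda>y. ln (g y)) \<nu>' \<longrightarrow> \<nu>' = \<nu>)"
proof -
  have cont_iff: "Omega_cont \<phi> \<longleftrightarrow> continuous_on UNIV \<phi>" for \<phi> :: "(nat \<Rightarrow> 'a) \<Rightarrow> real"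
    by (rule Omega_cont_iff_continuous[OF compact_M])
  interpret normalized_potential \<mu> g
  proof (rule normalized_potential.intro)
    show "0 < emeasure \<mu> U" if "open U" "U \<noteq> {}" for U
      using mu_supp that by blast
    show "continuous_on UNIV g" "\<And>x. 0 < g x" "\<And>x. (\<integral>a. g (cons_seq a x) \<partial>\<mu>) = 1"
      using g_G0 by (simp_all add: G0_def cont_iff)
  qed fact+
  let ?\<nu> = limit.representing_measure
  note sets_eq = sets_Omega_borel[OF compact_M]
  show ?thesis
  proof (intro exI[of _ ?\<nu>] conjI allI impI)
    show "sets ?\<nu> = sets Omega_borel"
      by (simp add: sets_eq)
    show "prob_space ?\<nu>"
      by (rule limit.prob_space_representing_measure)
    show "\<exists>N. \<forall>n\<ge>N. \<forall>x. \<bar>(L ^^ n) \<phi> x - (\<integral>y. \<phi> y \<partial>?\<nu>)\<bar> < e"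
      if "Omega_cont \<phi>" "0 < e" for \<phi> e
      using limit_functional_uniform[of \<phi> e] that by (simp add: cont_iff limit.integral_representing_measure)
    show "dual_fixed \<mu> (\<lambda>y. ln (g y)) ?\<nu>"
      unfolding dual_fixed_def cont_iff
      by (simp add: limit.integral_representing_measure continuous_on_L limit_functional_L)
  next
    fix \<nu>' :: "(nat \<Rightarrow> 'a) measure"
    assume \<nu>': "sets \<nu>' = sets Omega_borel \<and> prob_space \<nu>' \<and> dual_fixed \<mu> (\<lambda>y. ln (g y)) \<nu>'"
    then have p: "prob_space \<nu>'" "sets \<nu>' = sets borel"
      and f: "\<And>\<phi>. continuous_on UNIV \<phi> \<Longrightarrow> (\<integral>x. L \<phi> x \<partial>\<nu>') = (\<integral>x. \<phi> x \<partial>\<nu>')"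
      by (auto simp: sets_eq dual_fixed_def cont_iff)
    show "\<nu>' = ?\<nu>"
      using integral_eq_limit_functional[OF p f]
      by (intro prob_measure_eqI_integral_continuous[OF p(1) limit.prob_space_representing_measure p(2)])
        (simp_all add: limit.integral_representing_measure)
  qed
qed

end
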